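(* Let $k\ge3$. The space $(M(1)^++C_2(V_L^+))/C_2(V_L^+)$ is spanned by the classes of $L(-2)^sJ_{-1}^t\mathbf 1$, $s,t\in\mathbb{Z}_{\ge0}$.
   Context: $L=\mathbb{Z}\alpha$, $\langle\alpha,\alpha\rangle=2k$; $V_L=M(1)\otimes\mathbb{C}[L]$ the lattice VOA with conformal vector $\omega=\frac1{4k}\alpha(-1)^2\mathbf1$, $L(n)=\omega_{n+1}$; $V_L^+$ the fixed points of the involution $\theta$ lifted from $-1$ on $L$; $M(1)^+$ the $\theta$-fixed part of $M(1)$. $J=\frac{1}{4k^2}\alpha(-1)^4\mathbf1-\frac1k\alpha(-3)\alpha(-1)\mathbf1+\frac{3}{4k}\alpha(-2)^2\mathbf1$, $J_{-1}$ is the $(-1)$-mode of $Y(J,z)=\sum J_nz^{-n-1}$, and $L(-2)^s$, $J_{-1}^t$ denote operator powers. $C_2(V)$ is the span of $\{v_{-2}u:u,v\in V\}$. *)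

theory Defs
  imports Complex_Main "HOL-Library.Multiset"
begin

text \<open>Concrete model of the rank one lattice VOA V_L, L = Z alpha, (alpha,alpha) = 2k.
  A basis vector is indexed by (m, P) with m an integer and P a multiset of positive
  integers; it stands for alpha(-n_1)...alpha(-n_r) e^(m alpha), where P = {n_1,...,n_r}.
  Vectors are finitely supported coefficient functions on this index set.
  The cocycle is trivial (possible since L is even of rank one).\<close>

type_synonym vidx = "int \<times> nat multiset"
type_synonym vec = "vidx \<Rightarrow> complex"

definition bas :: "vidx \<Rightarrow> vec" where
  "bas b = (\<lambda>y. if y = b then 1 else 0)"

definition supp :: "vec \<Rightarrow> vidx set" where
  "supp u = {b. u b \<noteq> 0}"

definition lin :: "(vidx \<Rightarrow> vec) \<Rightarrow> vec \<Rightarrow> vec" where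
  "lin f u = (\<lambda>y. \<Sum>b\<in>supp u. u b * f b y)"

definition VL :: "vec set" where
  "VL = {u. finite (supp u) \<and> (\<forall>m P. u (m, P) \<noteq> 0 \<longrightarrow> 0 \<notin># P)}"

definition wt :: "nat \<Rightarrow> vidx \<Rightarrow> nat" where
  "wt k b = nat (int k * (fst b)^2) + sum_mset (snd b)"

definition heisb :: "nat \<Rightarrow> int \<Rightarrow> vidx \<Rightarrow> vec" where
  "heisb k j b = (case b of (m, P) \<Rightarrow>
     if j < 0 then bas (m, P + {# nat (- j) #})
     else if j = 0 then (\<lambda>y. of_nat (2 * k) * of_int m * bas (m, P) y)
     else (\<lambda>y. of_nat (2 * k) * of_int j * of_nat (count P (nat j)) * bas (m, P - {# nat j #}) y))"

definition heis :: "nat \<Rightarrow> int \<Rightarrow> vec \<Rightarrow> vec" where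
  "heis k j = lin (heisb k j)"

text \<open>Modes (e^(m0 alpha))_j on basis vectors, from
  Y(e^beta,z) = E^-(-beta,z) E^+(-beta,z) e^beta z^beta, written in the polynomial model
  alpha(-n) = x_n, alpha(n) = 2kn d/dx_n: here E^+ acts by x_n |-> x_n - 2k m0 z^(-n)
  and E^- is multiplication by exp(m0 sum_n x_n z^n / n).\<close>
definition ebb :: "nat \<Rightarrow> int \<Rightarrow> int \<Rightarrow> vidx \<Rightarrow> vec" where
  "ebb k m0 j b = (case b of (m1, P) \<Rightarrow> (\<lambda>y.
     \<Sum>Q\<in>{Q. Q \<subseteq># P}.
       \<Sum>R\<in>{R. 0 \<notin># R \<and> int (sum_mset R) = int (sum_mset Q) - 2 * int k * m0 * m1 - j - 1}.
         ((\<Prod>n\<in>set_mset P. of_nat (count P n choose count Q n))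
          * (- (of_nat (2 * k) * of_int m0)) ^ size Q
          * (of_int m0) ^ size R
          / (\<Prod>n\<in>set_mset R. of_nat (n ^ count R n * fact (count R n))))
         * bas (m0 + m1, P - Q + R) y))"

text \<open>Modes of alpha(-n_1)...alpha(-n_r) e^(m0 alpha), by the iterate formula
  (alpha(-n) v)_j = sum_(i>=0) binom(n+i-1,i) (alpha(-n-i) v_(j+i) + (-1)^(n+1) v_(j-n-i) alpha(i)).
  On a basis vector u the sum is finite; it is truncated at a bound beyond which all terms
  vanish by the weight grading.\<close>
primrec modeL :: "nat \<Rightarrow> int \<Rightarrow> nat list \<Rightarrow> int \<Rightarrow> vec \<Rightarrow> vec" where
  "modeL k m0 [] j = lin (ebb k m0 j)"
| "modeL k m0 (n # ns) j = lin (\<lambda>b. (\<lambda>y.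
     \<Sum>i\<in>{0..nat \<bar>j\<bar> + wt k (m0, mset ns) + wt k b}.
       of_nat ((n + i - 1) choose i)
       * (heis k (- int n - int i) (modeL k m0 ns (j + int i) (bas b)) y
          + (-1) ^ (n + 1) * modeL k m0 ns (j - int n - int i) (heis k (int i) (bas b)) y)))"

definition mode :: "nat \<Rightarrow> vec \<Rightarrow> int \<Rightarrow> vec \<Rightarrow> vec" where
  "mode k v j u = (\<lambda>y. \<Sum>b\<in>supp v. v b * modeL k (fst b) (sorted_list_of_multiset (snd b)) j u y)"

text \<open>The involution theta: alpha(-n) |-> -alpha(-n), e^beta |-> e^(-beta).\<close>
definition theta :: "vec \<Rightarrow> vec" where
  "theta u = (\<lambda>(m, P). (-1) ^ size P * u (- m, P))"

definition VLplus :: "vec set" where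
  "VLplus = {u \<in> VL. theta u = u}"

definition M1 :: "vec set" where
  "M1 = {u \<in> VL. \<forall>m P. u (m, P) \<noteq> 0 \<longrightarrow> m = 0}"

definition M1plus :: "vec set" where
  "M1plus = {u \<in> M1. theta u = u}"

definition cspan :: "vec set \<Rightarrow> vec set" where
  "cspan S = {u. \<exists>F c. finite F \<and> F \<subseteq> S \<and> u = (\<lambda>y. \<Sum>v\<in>F. c v * v y)}"

definition vsum :: "vec set \<Rightarrow> vec set \<Rightarrow> vec set" where
  "vsum A B = {(\<lambda>y. a y + b y) | a b. a \<in> A \<and> b \<in> B}"

definition C2VLplus :: "nat \<Rightarrow> vec set" where
  "C2VLplus k = cspan {mode k v (-2) u | u v. u \<in> VLplus \<and> v \<in> VLplus}"

definition vac :: vec where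
  "vac = bas (0, {#})"

definition omega :: "nat \<Rightarrow> vec" where
  "omega k = (\<lambda>y. (1 / of_nat (4 * k)) * bas (0, {#1, 1#}) y)"

definition Jv :: "nat \<Rightarrow> vec" where
  "Jv k = (\<lambda>y. (1 / of_nat (4 * k^2)) * bas (0, {#1, 1, 1, 1#}) y
             - (1 / of_nat k) * bas (0, {#3, 1#}) y
             + (3 / of_nat (4 * k)) * bas (0, {#2, 2#}) y)"

definition Lm2 :: "nat \<Rightarrow> vec \<Rightarrow> vec" where
  "Lm2 k = mode k (omega k) (-1)"

definition Jm1 :: "nat \<Rightarrow> vec \<Rightarrow> vec" where
  "Jm1 k = mode k (Jv k) (-1)"

end

theory Submission
  imports Defs "HOL-Library.Poly_Mapping" "HOL-Computational_Algebra.Polynomial"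
begin

text \<open>
  The Heisenberg algebra \<open>M(1)\<close> is the polynomial ring in \<open>X 1, X 2, \<dots>\<close>, and
  only the elements \<open>v\<^sub>-\<^sub>2 u\<close> with \<open>v\<close> quadratic are needed.  Up to a correction of
  lower degree they identify \<open>a X(a+1) X(b) u\<close> with \<open>- b X(a) X(b+1) u\<close>, so that weight
  can be moved between the factors of a monomial.  As \<open>X(1) X(2)\<close> is zero to leading order,
  every even monomial other than a power of \<open>X(1)\<close> becomes a multiple of some
  \<open>X(1) X(n)\<close>, and this vanishes for even \<open>n\<close>.  The operator \<open>L(-2)\<close> preserves the
  span of the \<open>v\<^sub>-\<^sub>2 u\<close>, and modulo that span it sends \<open>X(1) X(n)\<close>, for odd \<open>n \<ge> 3\<close>, to
  \<open>(n+2)(n+3)/4\<close> times \<open>X(1) X(n+2)\<close>; the factor includes the quantum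
  correction to \<open>X(1)\<^sup>3 X(n)\<close>.  Since \<open>L(-2)\<^sup>2 1\<close> and \<open>J\<close> together produce \<open>X(1)\<^sup>4\<close>
  and \<open>X(1) X(3)\<close>, induction on the weight reaches everything.
\<close>

subsection \<open>Polynomials\<close>

text \<open>Polynomial degree is only a filtration here: reducing a degree four monomial leaves
  corrections of degree two, and these fall on the same vector \<open>X 1 * X (n + 2)\<close> as the
  leading terms of \<open>L(-2)\<close> applied to \<open>X 1 * X n\<close>. They cannot be dropped,
  so for \<open>X 1 * X 1 * X 1 * X n\<close> the scalar is computed exactly; for general monomials
  it is enough that some scalar exists. What matters in the end is that the factor for
  \<open>L(-2)\<close> is nonzero, so that each even weight yields the next. The elements
  \<open>v_{-2} u\<close> are encoded by a coefficient function on pairs of modes and not by the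
  pair (a, b) of v = alpha(-a) alpha(-b) 1. Commuting with \<open>L(-2)\<close> mixes such pairs,
  whereas a bound on the degree of the coefficient function is visibly stable. All v and u that
  occur lie in \<open>M(1)^+\<close>, so only the sector \<open>m = 0\<close> of the lattice model
  has to be evaluated.\<close>

type_synonym heis_poly = "nat multiset \<Rightarrow>\<^sub>0 complex"

abbreviation const :: "complex \<Rightarrow> heis_poly" where
  "const c \<equiv> Poly_Mapping.single 0 c"

definition mon :: "nat multiset \<Rightarrow> heis_poly" where
  "mon P = Poly_Mapping.single P 1"

definition X :: "nat \<Rightarrow> heis_poly" where
  "X n = mon {#n#}"

lemma mon_empty [simp]: "mon {#} = 1"
  by (simp add: mon_def flip: zero_multiset_def)

lemma mon_add: "mon (P + Q) = mon P * mon Q"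
  by (simp add: mon_def mult_single)

lemma mon_add_mset: "mon (add_mset n P) = X n * mon P"
  using mon_add[of "{#n#}" P] by (simp add: X_def)

lemma const_mult: "const (a * b) = const a * const b"
  by (simp add: mult_single)

lemma const_add: "const (a + b) = const a + const b"
  by (rule single_add)

lemma const_mult_mon: "const c * mon P = Poly_Mapping.single P c"
  by (simp add: mon_def mult_single)

lemma lookup_const_mult: "Poly_Mapping.lookup (const c * p) P = c * Poly_Mapping.lookup p P"
  by (simp add: mult_map_scale_conv_mult[symmetric] map.rep_eq when_def)

definition ext :: "(nat multiset \<Rightarrow> heis_poly) \<Rightarrow> heis_poly \<Rightarrow> heis_poly" where
  "ext F p = (\<Sum>P\<in>Poly_Mapping.keys p. const (Poly_Mapping.lookup p P) * F P)"

lemma ext_superset: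
  assumes "finite A" "Poly_Mapping.keys p \<subseteq> A"
  shows "ext F p = (\<Sum>P\<in>A. const (Poly_Mapping.lookup p P) * F P)"
  unfolding ext_def using assms
  by (intro sum.mono_neutral_left) (auto simp: in_keys_iff)

lemma ext_add: "ext F (p + q) = ext F p + ext F q"
proof -
  let ?A = "Poly_Mapping.keys p \<union> Poly_Mapping.keys q"
  have "Poly_Mapping.keys (p + q) \<subseteq> ?A" by (rule keys_add)
  then show ?thesis
    by (simp add: ext_superset[of ?A] lookup_add const_add distrib_right sum.distrib)
qed

lemma ext_0 [simp]: "ext F 0 = 0"
  by (simp add: ext_def)

lemma ext_const_mult: "ext F (const c * p) = const c * ext F p"
proof -
  have "Poly_Mapping.keys (const c * p) \<subseteq> Poly_Mapping.keys p"
    by (auto simp: in_keys_iff lookup_const_mult)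
  then show ?thesis
    by (simp add: ext_superset[of "Poly_Mapping.keys p"] lookup_const_mult const_mult
        sum_distrib_left mult.assoc)
qed

lemma ext_mon [simp]: "ext F (mon P) = F P"
  by (simp add: ext_def mon_def)

lemma poly_expand: "p = (\<Sum>P\<in>Poly_Mapping.keys p. const (Poly_Mapping.lookup p P) * mon P)"
proof (rule poly_mapping_eqI)
  fix P
  have "Poly_Mapping.lookup (\<Sum>P\<in>Poly_Mapping.keys p. const (Poly_Mapping.lookup p P) * mon P) P
      = (\<Sum>Q\<in>Poly_Mapping.keys p. if Q = P then Poly_Mapping.lookup p P else 0)"
    by (auto simp: lookup_sum const_mult_mon lookup_single when_def intro!: sum.cong)
  also have "\<dots> = Poly_Mapping.lookup p P" by (simp add: in_keys_iff)
  finally show "Poly_Mapping.lookup p P = Poly_Mapping.lookup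
    (\<Sum>P\<in>Poly_Mapping.keys p. const (Poly_Mapping.lookup p P) * mon P) P" by simp
qed

text \<open>The monomial case is restricted to the keys of \<open>p\<close>, so that a hypothesis on
  the support of \<open>p\<close>, such as membership in \<open>parity False\<close>, remains
  available there.\<close>

lemma heis_poly_induct [case_names zero add scale mon]:
  assumes "R 0" "\<And>p q. R p \<Longrightarrow> R q \<Longrightarrow> R (p + q)" "\<And>c p. R p \<Longrightarrow> R (const c * p)"
    and "\<And>P. P \<in> Poly_Mapping.keys p \<Longrightarrow> R (mon P)"
  shows "R p"
proof -
  have "R (\<Sum>P\<in>A. const (Poly_Mapping.lookup p P) * mon P)"
    if "finite A" "A \<subseteq> Poly_Mapping.keys p" for A
    using that by (induction A) (auto intro: assms)
  from this[of "Poly_Mapping.keys p"] show ?thesis by (simp flip: poly_expand)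
qed

subsection \<open>Derivations\<close>

text \<open>The Leibniz rule on a monomial, with \<open>q\<close> running with multiplicity;
  \<open>der d\<close> is then the derivation sending \<open>X q\<close> to
  \<open>d q\<close>.\<close>

definition dmon :: "(nat \<Rightarrow> heis_poly) \<Rightarrow> nat multiset \<Rightarrow> heis_poly" where
  "dmon d P = (\<Sum>q\<in>#P. d q * mon (P - {#q#}))"

definition der :: "(nat \<Rightarrow> heis_poly) \<Rightarrow> heis_poly \<Rightarrow> heis_poly" where
  "der d = ext (dmon d)"

lemma dmon_add: "dmon d (P + Q) = dmon d P * mon Q + mon P * dmon d Q"
proof -
  have diff: "mon (P + Q - {#q#}) = mon (P - {#q#}) * mon Q" if "q \<in># P" for P Q q
    by (simp only: mon_add[symmetric] subset_mset.diff_add_assoc2[OF mset_subset_eq_single[OF that]])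
  have 1: "(\<Sum>q\<in>#P. d q * mon (P + Q - {#q#})) = dmon d P * mon Q" for P Q
  proof -
    have "(\<Sum>q\<in>#P. d q * mon (P + Q - {#q#})) = (\<Sum>q\<in>#P. d q * mon (P - {#q#}) * mon Q)"
      by (rule arg_cong[of _ _ sum_mset], rule image_mset_cong) (simp only: diff mult.assoc)
    then show ?thesis by (simp only: dmon_def sum_mset_distrib_right)
  qed
  show ?thesis
    unfolding dmon_def[of d "P + Q"] using 1[of P Q] 1[of Q P]
    by (simp add: add.commute[of Q P] mult.commute)
qed

lemma der_add: "der d (p + q) = der d p + der d q"
  by (simp add: der_def ext_add)

lemma der_0 [simp]: "der d 0 = 0"
  by (simp add: der_def)

lemma der_const_mult: "der d (const c * p) = const c * der d p"
  by (simp add: der_def ext_const_mult)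

lemma der_mon: "der d (mon P) = dmon d P"
  by (simp add: der_def)

lemma der_1 [simp]: "der d 1 = 0"
  using der_mon[of d "{#}"] by (simp add: dmon_def)

lemma der_const [simp]: "der d (const c) = 0"
  using der_const_mult[of d c 1] by simp

lemma der_X [simp]: "der d (X n) = d n"
  by (simp add: X_def der_mon dmon_def)

lemma der_sum: "der d (\<Sum>i\<in>A. f i) = (\<Sum>i\<in>A. der d (f i))"
  by (induction A rule: infinite_finite_induct) (auto simp: der_add)

lemma der_mult: "der d (p * q) = der d p * q + p * der d q"
proof (induction p rule: heis_poly_induct)
  case (mon P)
  show ?case
  proof (induction q rule: heis_poly_induct)
    case (mon Q)
    show ?case by (simp add: der_mon dmon_add flip: mon_add)
  next
    case (scale c q)
    have "der d (mon P * (const c * q)) = const c * der d (mon P * q)"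
      unfolding mult.left_commute[of "mon P"] by (rule der_const_mult)
    then show ?case unfolding scale der_const_mult by (simp only: algebra_simps)
  qed (auto simp: der_add algebra_simps)
next
  case (scale c p)
  then show ?case by (simp add: mult.assoc der_const_mult distrib_left)
qed (auto simp: der_add algebra_simps)

text \<open>A derivation is determined by its values on the variables.
  \<open>der_commutator\<close>, \<open>der_fun_add\<close> and \<open>der_fun_mult\<close> follow
  by applying this to the difference of their two sides.\<close>

lemma derivation_eq_0:
  assumes add: "\<And>p q. D (p + q) = D p + D q"
    and scale: "\<And>c p. D (const c * p) = const c * D p"
    and mult: "\<And>p q. D (p * q) = D p * q + p * D q"
    and X: "\<And>n. D (X n) = 0"
  shows "D p = 0"
proof (induction p rule: heis_poly_induct)
  case zero
  show ?case using add[of 0 0] by simp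
next
  case (mon P)
  show ?case
  proof (induction P)
    case empty
    show ?case using mult[of 1 1] by simp
  qed (simp add: mon_add_mset mult X)
qed (simp_all add: add scale)

lemma der_commutator:
  "der d (der e p) - der e (der d p) = der (\<lambda>n. der d (e n) - der e (d n)) p"
proof -
  define D where "D p = der d (der e p) - der e (der d p)
    - der (\<lambda>n. der d (e n) - der e (d n)) p" for p
  have "D p = 0"
    by (rule derivation_eq_0) (simp_all add: D_def der_add der_const_mult der_mult algebra_simps)
  then show ?thesis by (simp add: D_def)
qed

lemma der_fun_add: "der (\<lambda>n. d n + e n) p = der d p + der e p"
proof -
  have "der (\<lambda>n. d n + e n) p - der d p - der e p = 0"
    by (rule derivation_eq_0) (simp_all add: der_add der_const_mult der_mult algebra_simps)
  then show ?thesis by (simp add: algebra_simps)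
qed

lemma der_fun_mult: "der (\<lambda>n. c * d n) p = c * der d p"
proof -
  have "der (\<lambda>n. c * d n) p - c * der d p = 0"
    by (rule derivation_eq_0) (simp_all add: der_add der_const_mult der_mult algebra_simps)
  then show ?thesis by (simp add: algebra_simps)
qed

lemma der_fun_0 [simp]: "der (\<lambda>n. 0) p = 0"
  using der_fun_mult[of 0 "\<lambda>_. 0" p] by simp

lemma der_fun_sum: "der (\<lambda>n. \<Sum>i\<in>A. d i n) p = (\<Sum>i\<in>A. der (d i) p)"
  by (induction A rule: infinite_finite_induct) (auto simp: der_fun_add)

lemma der_mon_cong:
  assumes "\<And>n. n \<in># P \<Longrightarrow> d n = e n"
  shows "der d (mon P) = der e (mon P)"
  unfolding der_mon dmon_def using assms by (auto intro!: arg_cong[of _ _ sum_mset] image_mset_cong)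

subsection \<open>Parity\<close>

text \<open>\<open>True\<close> stands for odd degree. The variable \<open>X 0\<close> is excluded
  as well, which makes \<open>parity False\<close> the exact counterpart of
  \<open>M(1)^+\<close>.\<close>

definition parity :: "bool \<Rightarrow> heis_poly set" where
  "parity b = {p. \<forall>P\<in>Poly_Mapping.keys p. odd (size P) = b \<and> 0 \<notin># P}"

lemma parity_0 [simp]: "0 \<in> parity b"
  by (simp add: parity_def)

lemma parity_add: "p \<in> parity b \<Longrightarrow> q \<in> parity b \<Longrightarrow> p + q \<in> parity b"
  unfolding parity_def using keys_add[of p q] by blast

lemma parity_sum: "(\<And>i. i \<in> A \<Longrightarrow> f i \<in> parity b) \<Longrightarrow> (\<Sum>i\<in>A. f i) \<in> parity b"
  by (induction A rule: infinite_finite_induct) (auto simp: parity_add)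

lemma parity_const_mult: "p \<in> parity b \<Longrightarrow> const c * p \<in> parity b"
  by (auto simp: parity_def in_keys_iff lookup_const_mult)

lemma parity_mult:
  assumes "p \<in> parity a" "q \<in> parity b"
  shows "p * q \<in> parity (a \<noteq> b)"
  unfolding parity_def
proof (intro CollectI ballI)
  fix P assume "P \<in> Poly_Mapping.keys (p * q)"
  then obtain A B where "A \<in> Poly_Mapping.keys p" "B \<in> Poly_Mapping.keys q" "P = A + B"
    using keys_mult by blast
  then show "odd (size P) = (a \<noteq> b) \<and> 0 \<notin># P"
    using assms by (auto simp: parity_def)
qed

lemma mon_in_parity [simp]: "mon P \<in> parity b \<longleftrightarrow> odd (size P) = b \<and> 0 \<notin># P"
  by (simp add: parity_def mon_def)

lemma one_in_parity [simp]: "1 \<in> parity b \<longleftrightarrow> \<not> b"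
  using mon_in_parity[of "{#}" b] by simp

lemma X_in_parity [simp]: "X n \<in> parity b \<longleftrightarrow> b \<and> n > 0"
  by (auto simp: X_def)

lemma parity_mult_XX: "p \<in> parity b \<Longrightarrow> m > 0 \<Longrightarrow> n > 0 \<Longrightarrow> X m * X n * p \<in> parity b"
  using parity_mult[of "X m * X n" False p b] parity_mult[of "X m" True "X n" True] by simp

lemma parity_ext:
  assumes "p \<in> parity b" "\<And>P. odd (size P) = b \<Longrightarrow> 0 \<notin># P \<Longrightarrow> F P \<in> parity c"
  shows "ext F p \<in> parity c"
  unfolding ext_def using assms
  by (intro parity_sum parity_const_mult) (auto simp: parity_def)

lemma parity_der:
  assumes "p \<in> parity b" "\<And>n. n > 0 \<Longrightarrow> d n \<in> parity c"
  shows "der d p \<in> parity (b = c)"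
  unfolding der_def
proof (rule parity_ext[OF assms(1)])
  fix P :: "nat multiset" assume P: "odd (size P) = b" "0 \<notin># P"
  \<comment> \<open>The summation range is generalised to a submultiset \<open>M\<close>, since the
    \<open>P\<close> inside the summand must stay fixed during the induction.\<close>
  have "(\<Sum>q\<in>#M. d q * mon (P - {#q#})) \<in> parity (b = c)" if "M \<subseteq># P" for M
    using that
  proof (induction M)
    case (add q M)
    have q: "q \<in># P" and M: "M \<subseteq># P"
      using mset_subset_eq_insertD[OF add.prems] by (auto simp: subset_mset.less_imp_le)
    obtain P' where P': "P = add_mset q P'" using mset_add[OF q] by blast
    have "mon (P - {#q#}) \<in> parity (\<not> b)" using P by (auto simp: P')
    moreover have "d q \<in> parity c" using q P by (intro assms(2)) (metis gr0I)
    ultimately have "d q * mon (P - {#q#}) \<in> parity (b = c)"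
      using parity_mult[of "d q" c "mon (P - {#q#})" "\<not> b"] by (cases b; cases c) auto
    then show ?case using add.IH[OF M] by (simp add: parity_add)
  qed simp
  then show "dmon d P \<in> parity (b = c)" by (simp add: dmon_def)
qed

subsection \<open>Quadratic operators\<close>

text \<open>\<^term>\<open>qop k N g\<close> is the normally ordered sum of
  \<open>g(-p) : \<alpha>(p) \<alpha>(q) :\<close> over all integers with \<open>p + q = -N\<close>,
  where \<open>\<alpha>(-n)\<close> is multiplication by \<open>X n\<close> and \<open>\<alpha>(n)\<close> is
  \<open>2kn\<close> times the partial derivative in \<open>X n\<close>.\<close>

definition quad :: "nat \<Rightarrow> (complex \<Rightarrow> complex) \<Rightarrow> heis_poly" where
  "quad N g = (\<Sum>a\<in>{1..<N}. const (g (of_nat a)) * (X a * X (N - a)))"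

text \<open>The normally ordered pairs with one annihilator: \<open>\<alpha>(q)\<close> comes with
  \<open>\<alpha>(-N-q)\<close> in either order, whence the two values of \<open>g\<close>. Two
  annihilators cannot add up to a negative index, and \<open>\<alpha>(0)\<close> is zero on
  \<open>M(1)\<close>.\<close>

definition qder :: "nat \<Rightarrow> nat \<Rightarrow> (complex \<Rightarrow> complex) \<Rightarrow> nat \<Rightarrow> heis_poly" where
  "qder k N g q = const (of_nat (2 * k * q) * (g (- of_nat q) + g (of_nat (N + q)))) * X (N + q)"

definition qop :: "nat \<Rightarrow> nat \<Rightarrow> (complex \<Rightarrow> complex) \<Rightarrow> heis_poly \<Rightarrow> heis_poly" where
  "qop k N g u = quad N g * u + der (qder k N g) u"

lemma qop_add: "qop k N g (p + q) = qop k N g p + qop k N g q"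
  by (simp add: qop_def der_add algebra_simps)

lemma qop_0 [simp]: "qop k N g 0 = 0"
  by (simp add: qop_def)

lemma qop_const_mult: "qop k N g (const c * p) = const c * qop k N g p"
  by (simp add: qop_def der_const_mult distrib_left mult.left_commute)

lemma parity_qop:
  assumes "p \<in> parity b"
  shows "qop k N g p \<in> parity b"
proof -
  have "quad N g * p \<in> parity b"
    unfolding quad_def sum_distrib_right using assms
    by (auto simp: mult.assoc intro!: parity_sum parity_const_mult parity_mult_XX[unfolded mult.assoc])
  moreover have "der (qder k N g) p \<in> parity (b = True)"
    by (rule parity_der[OF assms]) (auto simp: qder_def intro!: parity_const_mult)
  ultimately show ?thesis by (simp add: qop_def parity_add)
qed

lemma quad_linear: "quad N (\<lambda>z. \<Sum>i\<in>I. c i * g i z) = (\<Sum>i\<in>I. const (c i) * quad N (g i))"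
proof (induction I rule: infinite_finite_induct)
  case (insert i I)
  then show ?case
    by (simp add: quad_def const_add const_mult sum.distrib sum_distrib_left algebra_simps)
qed (simp_all add: quad_def)

lemma qder_linear:
  "qder k N (\<lambda>z. \<Sum>i\<in>I. c i * g i z) = (\<lambda>q. \<Sum>i\<in>I. const (c i) * qder k N (g i) q)"
proof (induction I rule: infinite_finite_induct)
  case (insert i I)
  show ?case
  proof
    fix q
    have *: "(\<Sum>i\<in>I. const (c i) * qder k N (g i) q) = qder k N (\<lambda>z. \<Sum>i\<in>I. c i * g i z) q"
      using insert.IH by (simp add: fun_eq_iff)
    show "qder k N (\<lambda>z. \<Sum>i\<in>insert i I. c i * g i z) q
        = (\<Sum>i\<in>insert i I. const (c i) * qder k N (g i) q)"
      unfolding sum.insert[OF insert.hyps] * 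
      by (simp add: qder_def flip: mult.assoc const_mult distrib_right const_add)
        (simp add: algebra_simps)
  qed
qed (simp_all add: qder_def)

lemma qop_linear:
  "qop k N (\<lambda>z. \<Sum>i\<in>I. c i * g i z) u = (\<Sum>i\<in>I. const (c i) * qop k N (g i) u)"
  by (simp add: qop_def quad_linear qder_linear der_fun_sum der_fun_mult sum.distrib
      sum_distrib_right mult.assoc distrib_left)

text \<open>The two factors commute inside the normal ordering, so exchanging them replaces
  \<open>z\<close> by \<open>N - z\<close>.\<close>

lemma qop_reflect: "qop k N (\<lambda>z. g (of_nat N - z)) = qop k N g"
proof -
  have "quad N (\<lambda>z. g (of_nat N - z)) = quad N g"
    unfolding quad_def
    by (rule sum.reindex_bij_witness[of _ "\<lambda>a. N - a" "\<lambda>a. N - a"])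
      (auto simp: of_nat_diff mult.commute)
  moreover have "qder k N (\<lambda>z. g (of_nat N - z)) = qder k N g"
    by (simp add: qder_def fun_eq_iff algebra_simps)
  ultimately show ?thesis by (intro ext) (simp only: qop_def)
qed

section \<open>\<open>L(-2)\<close> and its commutator with quadratic operators\<close>

definition Lm2_op :: "nat \<Rightarrow> heis_poly \<Rightarrow> heis_poly" where
  "Lm2_op k u = const (1 / of_nat (4 * k)) * qop k 2 (\<lambda>_. 1) u"

text \<open>The derivation part expresses
  \<open>[L(-2), \<alpha>(-q)] = q \<alpha>(-q-2)\<close>.\<close>

lemma Lm2_op_eq:
  assumes "k > 0"
  shows "Lm2_op k u = const (1 / of_nat (4 * k)) * (X 1 * X 1) * u
    + der (\<lambda>q. const (of_nat q) * X (q + 2)) u"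
proof -
  have "quad 2 (\<lambda>_. 1) = X 1 * X 1"
  proof -
    have "{1..<2::nat} = {1}" by auto
    then show ?thesis by (simp add: quad_def)
  qed
  moreover have "const (1 / of_nat (4 * k)) * der (qder k 2 (\<lambda>_. 1)) u
      = der (\<lambda>q. const (of_nat q) * X (q + 2)) u"
    unfolding der_fun_mult[symmetric]
  proof (rule arg_cong[of _ _ "\<lambda>d. der d u"], rule ext)
    fix q
    show "const (1 / of_nat (4 * k)) * qder k 2 (\<lambda>_. 1) q = const (of_nat q) * X (q + 2)"
      unfolding qder_def mult.assoc[symmetric] const_mult[symmetric] using assms
      by (simp add: add.commute)
  qed
  ultimately show ?thesis by (simp add: Lm2_op_def qop_def distrib_left mult.assoc)
qed

lemma Lm2_op_add: "Lm2_op k (p + q) = Lm2_op k p + Lm2_op k q"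
  by (simp add: Lm2_op_def qop_add distrib_left)

lemma Lm2_op_const_mult: "Lm2_op k (const c * p) = const c * Lm2_op k p"
  by (simp add: Lm2_op_def qop_const_mult mult.left_commute)

lemma parity_Lm2_op: "p \<in> parity b \<Longrightarrow> Lm2_op k p \<in> parity b"
  by (simp add: Lm2_op_def parity_const_mult parity_qop)

text \<open>\<open>S1\<close> and \<open>S2\<close> collect the terms in which the first,
  respectively the second, factor is raised by 2. Reindexed to \<open>N + 2\<close>, the new
  coefficient function agrees with them except at the ends 1 and \<open>N + 1\<close>, since it
  contributes zero at 2 to the first sum and at \<open>N\<close> to the second. The two end terms
  are what \<open>qder\<close> produces from the \<open>X 1 * X 1\<close> of
  \<open>L(-2)\<close>.\<close>

lemma quad_commutator:
  assumes "k > 0" "N \<ge> 1"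
  shows "der (\<lambda>q. const (of_nat q) * X (q + 2)) (quad N g)
      - der (qder k N g) (const (1 / of_nat (4 * k)) * (X 1 * X 1))
    = quad (N + 2) (\<lambda>z. (z - 2) * g (z - 2) + (of_nat N - z) * g z)"
proof -
  define S1 where "S1 = (\<Sum>a\<in>{1..<N}. const (of_nat a * g (of_nat a)) * (X (a + 2) * X (N - a)))"
  define S2 where "S2 = (\<Sum>a\<in>{1..<N}. const (of_nat (N - a) * g (of_nat a)) * (X a * X (N - a + 2)))"
  have "der (\<lambda>q. const (of_nat q) * X (q + 2)) (const c * (X a * X b))
      = const (of_nat a * c) * (X (a + 2) * X b) + const (of_nat b * c) * (X a * X (b + 2))" for a b c
    unfolding der_const_mult unfolding der_mult der_X const_mult distrib_left
    by (simp only: ac_simps)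
  then have 1: "der (\<lambda>q. const (of_nat q) * X (q + 2)) (quad N g) = S1 + S2"
    unfolding quad_def der_sum S1_def S2_def sum.distrib[symmetric] by (simp only:)
  have 2: "der (qder k N g) (const (1 / of_nat (4 * k)) * (X 1 * X 1))
      = const (g (- 1) + g (of_nat (N + 1))) * (X 1 * X (N + 1))"
  proof -
    have "der (qder k N g) (const (1 / of_nat (4 * k)) * (X 1 * X 1))
        = const (1 / of_nat (4 * k)) * (const 2 * qder k N g 1) * X 1"
      by (simp add: der_const_mult der_mult algebra_simps)
    also have "const (1 / of_nat (4 * k)) * (const 2 * qder k N g 1)
        = const (g (- 1) + g (of_nat (N + 1))) * X (N + 1)"
      unfolding qder_def mult.assoc[symmetric] const_mult[symmetric] using assms by simp
    finally show ?thesis by (simp add: algebra_simps)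
  qed
  have 3: "(\<Sum>b\<in>{1..<N + 2}. const ((of_nat b - 2) * g (of_nat b - 2)) * (X b * X (N + 2 - b)))
      = S1 - const (g (- 1)) * (X 1 * X (N + 1))"
  proof -
    have *: "{1..<N + 2} = insert 1 (insert 2 {1 + 2..<N + 2})" using assms by auto
    have "(\<Sum>b\<in>{1 + 2..<N + 2}. const ((of_nat b - 2) * g (of_nat b - 2)) * (X b * X (N + 2 - b)))
        = (\<Sum>a\<in>{1..<N}. const (of_nat a * g (of_nat a)) * (X (a + 2) * X (N - a)))"
      unfolding sum.shift_bounds_nat_ivl by (intro sum.cong) auto
    then show ?thesis unfolding * S1_def by (simp add: single_uminus)
  qed
  have 4: "(\<Sum>b\<in>{1..<N + 2}. const ((of_nat N - of_nat b) * g (of_nat b)) * (X b * X (N + 2 - b)))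
      = S2 - const (g (of_nat (N + 1))) * (X 1 * X (N + 1))"
  proof -
    have *: "{1..<N + 2} = insert (N + 1) (insert N {1..<N})" using assms by auto
    have "(\<Sum>b\<in>{1..<N}. const ((of_nat N - of_nat b) * g (of_nat b)) * (X b * X (N + 2 - b))) = S2"
      unfolding S2_def by (intro sum.cong) (auto simp: of_nat_diff Suc_diff_le)
    then show ?thesis unfolding * by (simp add: single_uminus mult.commute)
  qed
  have "quad (N + 2) (\<lambda>z. (z - 2) * g (z - 2) + (of_nat N - z) * g z)
     = S1 + S2 - const (g (- 1) + g (of_nat (N + 1))) * (X 1 * X (N + 1))"
    unfolding quad_def const_add distrib_right sum.distrib 3 4 by simp
  then show ?thesis using 1 2 by simp
qed

text \<open>Raising the factor of index \<open>z\<close> multiplies by \<open>z\<close> and moves it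
  to \<open>z + 2\<close>, which gives the first summand of the new coefficient function; raising
  the partner of index \<open>N - z\<close> gives the second. The multiplication parts are compared
  by \<open>quad_commutator\<close>, the derivation parts on the variables.\<close>

lemma Lm2_op_qop:
  assumes "k > 0" "N \<ge> 1"
  shows "Lm2_op k (qop k N g u) = qop k N g (Lm2_op k u)
    + qop k (N + 2) (\<lambda>z. (z - 2) * g (z - 2) + (of_nat N - z) * g z) u"
proof -
  define e where "e q = const (of_nat q) * X (q + 2)" for q
  define B where "B = const (1 / of_nat (4 * k)) * (X 1 * X 1)"
  define h where "h z = (z - 2) * g (z - 2) + (of_nat N - z) * g z" for z
  have L: "Lm2_op k u = B * u + der e u" for u
    by (simp add: Lm2_op_eq[OF assms(1)] B_def e_def[abs_def])
  have quad: "der e (quad N g) = quad (N + 2) h + der (qder k N g) B"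
    using quad_commutator[OF assms, of g] unfolding B_def e_def[abs_def] h_def[abs_def]
    by (simp add: algebra_simps)
  have "der e (qder k N g n) - der (qder k N g) (e n) = qder k (N + 2) h n" for n
  proof -
    have 1: "der e (qder k N g n) = const (of_nat (2 * k * n) *
      (g (- of_nat n) + g (of_nat (N + n))) * of_nat (N + n)) * X (N + 2 + n)"
      unfolding qder_def der_const_mult der_X e_def
      by (simp add: const_mult add.assoc add.commute[of 2] mult.assoc)
    have 2: "der (qder k N g) (e n) = const (of_nat n * (of_nat (2 * k * (n + 2)) *
      (g (- of_nat (n + 2)) + g (of_nat (N + (n + 2)))))) * X (N + 2 + n)"
      unfolding qder_def der_const_mult der_X e_def
      by (simp only: const_mult mult.assoc add.assoc add.commute[of n 2])
    show ?thesis
      unfolding 1 2 unfolding qder_def left_diff_distrib[symmetric] single_diff[symmetric]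
      by (rule arg_cong[of _ _ "\<lambda>c. const c * _"]) (simp add: h_def algebra_simps)
  qed
  then have "der e (der (qder k N g) u) - der (qder k N g) (der e u) = der (qder k (N + 2) h) u"
    using der_commutator[of e "qder k N g" u] by simp
  then have "der e (der (qder k N g) u) = der (qder k N g) (der e u) + der (qder k (N + 2) h) u"
    by (simp add: algebra_simps)
  then have "Lm2_op k (qop k N g u) = qop k N g (Lm2_op k u) + qop k (N + 2) h u"
    unfolding L qop_def by (simp add: der_add der_mult quad algebra_simps)
  then show ?thesis by (simp add: h_def[abs_def])
qed

text \<open>The span of all \<open>v\<^sub>-\<^sub>2 u\<close> with \<open>v\<close> quadratic: for \<open>v\<close> of weight
  \<open>N - 1\<close> the coefficient functions that occur are exactly the polynomials of degree at most
  \<open>N - 3\<close> (lemma \<open>bpoly_spanning\<close>).\<close>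

inductive_set C2quad :: "nat \<Rightarrow> heis_poly set" for k where
  zero: "0 \<in> C2quad k"
| add: "p \<in> C2quad k \<Longrightarrow> q \<in> C2quad k \<Longrightarrow> p + q \<in> C2quad k"
| scale: "p \<in> C2quad k \<Longrightarrow> const c * p \<in> C2quad k"
| gen: "degree f + 3 \<le> N \<Longrightarrow> u \<in> parity False \<Longrightarrow> qop k N (poly f) u \<in> C2quad k"

lemma C2quad_Lm2_op:
  assumes "k > 0" "p \<in> C2quad k"
  shows "Lm2_op k p \<in> C2quad k"
  using assms(2)
proof induction
  case zero
  then show ?case by (simp add: Lm2_op_def C2quad.zero)
next
  case (add p q)
  then show ?case by (simp add: Lm2_op_add C2quad.add)
next
  case (scale p c)
  then show ?case by (simp add: Lm2_op_const_mult C2quad.scale)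
next
  case (gen f N u)
  \<comment> \<open>The coefficient function of the commutator as a polynomial. Its degree exceeds
    that of \<open>f\<close> by at most 1 while \<open>N\<close> grows by 2, so the bound for
    generators survives.\<close>
  define h where "h = [:-2, 1:] * pcompose f [:-2, 1:] + [:of_nat N, -1:] * f"
  have "degree (pcompose f [:-2, 1:]) \<le> degree f"
    using degree_pcompose_le[of f "[:-2, 1:]"] by simp
  then have "degree h \<le> degree f + 1"
    unfolding h_def by (intro degree_add_le order_trans[OF degree_mult_le]) auto
  then have "qop k (N + 2) (poly h) u \<in> C2quad k"
    using gen by (intro C2quad.gen) auto
  moreover have "poly h = (\<lambda>z. (z - 2) * poly f (z - 2) + (of_nat N - z) * poly f z)"
    by (auto simp: h_def poly_pcompose algebra_simps)
  moreover have "qop k N (poly f) (Lm2_op k u) \<in> C2quad k"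
    using gen by (intro C2quad.gen parity_Lm2_op)
  ultimately show ?case
    using Lm2_op_qop[OF assms(1), of N "poly f" u] gen by (simp add: C2quad.add)
qed

subsection \<open>Reduction modulo quadratic elements of C2\<close>

lemma C2quad_uminus: "p \<in> C2quad k \<Longrightarrow> - p \<in> C2quad k"
  using C2quad.scale[of p k "-1"] by (simp add: single_uminus)

lemma C2quad_diff: "p \<in> C2quad k \<Longrightarrow> q \<in> C2quad k \<Longrightarrow> p - q \<in> C2quad k"
  using C2quad.add[of p k "- q"] by (simp add: C2quad_uminus)

lemma C2quad_of_nat_mult: "p \<in> C2quad k \<Longrightarrow> of_nat n * p \<in> C2quad k"
  using C2quad.scale[of p k "of_nat n"] by simp

lemma const_inverse_mult: "c \<noteq> 0 \<Longrightarrow> const (inverse c) * (const c * p) = p"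
  by (simp add: const_mult[symmetric] mult.assoc[symmetric])

lemma C2quad_cancel: "const c * p \<in> C2quad k \<Longrightarrow> c \<noteq> 0 \<Longrightarrow> p \<in> C2quad k"
  using C2quad.scale[of "const c * p" k "inverse c"] by (simp add: const_inverse_mult)

lemma C2quad_cancel_of_nat: "of_nat n * p \<in> C2quad k \<Longrightarrow> n > 0 \<Longrightarrow> p \<in> C2quad k"
  using C2quad_cancel[of "of_nat n" p k] by simp

section \<open>Binomial coefficient functions and the shift relation\<close>

definition gpoly :: "nat \<Rightarrow> complex poly" where
  "gpoly m = smult (1 / fact m) (\<Prod>i\<in>{0..<m}. [:- of_nat i, 1:])"

lemma poly_gpoly [simp]: "poly (gpoly m) z = z gchoose m"
  by (simp add: gpoly_def gbinomial_prod_rev poly_prod)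

lemma degree_gpoly: "degree (gpoly m) \<le> m"
proof -
  have "degree (\<Prod>i\<in>{0..<m}. [:- of_nat i, 1 :: complex:])
      \<le> sum (degree \<circ> (\<lambda>i. [:- of_nat i, 1 :: complex:])) {0..<m}"
    by (rule degree_prod_sum_le) simp
  then show ?thesis unfolding gpoly_def by (intro order_trans[OF degree_smult_le]) simp
qed

text \<open>The coefficient function of the mode \<open>(\<alpha>(-a) \<alpha>(-b))\<^sub>j\<close>, where
  \<open>N = a + b - 1 - j\<close>.\<close>

definition bfun :: "nat \<Rightarrow> nat \<Rightarrow> nat \<Rightarrow> complex \<Rightarrow> complex" where
  "bfun N a b z = (z - 1 gchoose (a - 1)) * (of_nat N - 1 - z gchoose (b - 1))"

text \<open>The case \<open>N = a + b + 1\<close>, that is \<open>j = -2\<close>, of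
  \<open>bfun\<close>, written as a polynomial to make its degree available.\<close>

definition bpoly :: "nat \<Rightarrow> nat \<Rightarrow> complex poly" where
  "bpoly a b = pcompose (gpoly (a - 1)) [:-1, 1:] * pcompose (gpoly (b - 1)) [:of_nat (a + b), -1:]"

lemma poly_bpoly: "poly (bpoly a b) = bfun (a + b + 1) a b"
  by (simp add: fun_eq_iff bpoly_def bfun_def poly_pcompose)

lemma degree_bpoly:
  assumes "a \<ge> 1" "b \<ge> 1"
  shows "degree (bpoly a b) + 2 \<le> a + b"
proof -
  have "degree (pcompose (gpoly m) [:c, d:]) \<le> m" for m c d
    by (rule order_trans[OF degree_pcompose_le])
      (metis degree_gpoly degree_pCons_le degree_pCons_0 mult_le_mono mult.right_neutral One_nat_def)
  then have "degree (bpoly a b) \<le> (a - 1) + (b - 1)"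
    unfolding bpoly_def by (intro order_trans[OF degree_mult_le] add_mono)
  then show ?thesis using assms by linarith
qed

lemma bfun_of_nat:
  assumes "1 \<le> i" "i \<le> a + b"
  shows "bfun (a + b + 1) a b (of_nat i) = of_nat ((i - 1 choose (a - 1)) * (a + b - i choose (b - 1)))"
proof -
  have "(of_nat i :: complex) - 1 = of_nat (i - 1)"
    "(of_nat (a + b + 1) :: complex) - 1 - of_nat i = of_nat (a + b - i)"
    using assms by (simp_all add: of_nat_diff)
  then show ?thesis by (simp add: bfun_def binomial_gbinomial)
qed

text \<open>The first binomial vanishes for \<open>i < a\<close> and the second for
  \<open>i > a + 1\<close>, so two terms remain. They form \<open>L(-1) v\<close> for v = alpha(-a)
  alpha(-b) 1, in accordance with \<open>v_{-2} 1 = L(-1) v\<close>.\<close>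

lemma quad_bfun:
  assumes "a \<ge> 1" "b \<ge> 1"
  shows "quad (a + b + 1) (bfun (a + b + 1) a b)
    = of_nat a * (X (a + 1) * X b) + of_nat b * (X a * X (b + 1))"
proof -
  have "quad (a + b + 1) (bfun (a + b + 1) a b)
      = (\<Sum>i\<in>{1..<a + b + 1}. of_nat ((i - 1 choose (a - 1)) * (a + b - i choose (b - 1)))
          * (X i * X (a + b + 1 - i)))"
    unfolding quad_def
  proof (intro sum.cong refl)
    fix i assume "i \<in> {1..<a + b + 1}"
    then have "1 \<le> i" "i \<le> a + b" by auto
    from bfun_of_nat[OF this] show "const (bfun (a + b + 1) a b (of_nat i)) * (X i * X (a + b + 1 - i))
        = of_nat ((i - 1 choose (a - 1)) * (a + b - i choose (b - 1))) * (X i * X (a + b + 1 - i))"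
      by (simp only: single_of_nat)
  qed
  also have "\<dots> = (\<Sum>i\<in>{a, a + 1}. of_nat ((i - 1 choose (a - 1)) * (a + b - i choose (b - 1)))
          * (X i * X (a + b + 1 - i)))"
  proof (rule sum.mono_neutral_right, goal_cases)
    case 3
    show ?case
    proof
      fix i assume i: "i \<in> {1..<a + b + 1} - {a, a + 1}"
      then have "i - 1 < a - 1 \<or> a + b - i < b - 1" by auto
      then have "(i - 1 choose (a - 1)) * (a + b - i choose (b - 1)) = 0" by auto
      then show "of_nat ((i - 1 choose (a - 1)) * (a + b - i choose (b - 1)))
          * (X i * X (a + b + 1 - i)) = 0" by (simp only: of_nat_0 mult_zero_left)
    qed
  qed (use assms in auto)
  also have "\<dots> = of_nat b * (X a * X (b + 1)) + of_nat a * (X (a + 1) * X b)"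
  proof -
    have "(a choose (a - 1)) = a" "(b choose (b - 1)) = b"
      using assms by (simp_all add: binomial_symmetric)
    then show ?thesis using assms by (simp add: Suc_diff_le)
  qed
  finally show ?thesis by simp
qed

lemma C2quad_shift:
  assumes "a \<ge> 1" "b \<ge> 1" "u \<in> parity False"
  shows "(of_nat a * (X (a + 1) * X b) + of_nat b * (X a * X (b + 1))) * u
    + der (qder k (a + b + 1) (bfun (a + b + 1) a b)) u \<in> C2quad k"
proof -
  have "qop k (a + b + 1) (poly (bpoly a b)) u \<in> C2quad k"
    using degree_bpoly[OF assms(1,2)] assms(3) by (intro C2quad.gen) auto
  then show ?thesis unfolding qop_def poly_bpoly quad_bfun[OF assms(1,2)] .
qed

text \<open>The correction is a derivation applied to \<open>u\<close> and vanishes at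
  \<open>u = 1\<close>, so relations between degree two monomials are exact.\<close>

lemma C2quad_shift_1:
  assumes "a \<ge> 1" "b \<ge> 1"
  shows "of_nat a * (X (a + 1) * X b) + of_nat b * (X a * X (b + 1)) \<in> C2quad k"
  using C2quad_shift[OF assms, of 1 k] by simp

section \<open>Normal form of monomials of a given weight\<close>

definition quad_rep :: "nat \<Rightarrow> heis_poly" where
  "quad_rep w = X 1 * X (w - 1)"

text \<open>The scalar is left unspecified; where its value matters it is determined by
  \<open>C2quad_X3\<close>, \<open>C2quad_X4\<close> and \<open>C2quad_X1_cubed\<close>.\<close>

definition quad_rep_mod_C2 :: "nat \<Rightarrow> nat \<Rightarrow> heis_poly set" where
  "quad_rep_mod_C2 k w = {u. \<exists>c. u - const c * quad_rep w \<in> C2quad k}"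

lemma quad_rep_mod_C2_K: "p \<in> C2quad k \<Longrightarrow> p \<in> quad_rep_mod_C2 k w"
  unfolding quad_rep_mod_C2_def by (intro CollectI exI[of _ 0]) simp

lemma quad_rep_mod_C2_Y: "quad_rep w \<in> quad_rep_mod_C2 k w"
  unfolding quad_rep_mod_C2_def by (intro CollectI exI[of _ 1]) (simp add: C2quad.zero)

lemma quad_rep_mod_C2_add:
  assumes "p \<in> quad_rep_mod_C2 k w" "q \<in> quad_rep_mod_C2 k w"
  shows "p + q \<in> quad_rep_mod_C2 k w"
proof -
  obtain c d where "p - const c * quad_rep w \<in> C2quad k" "q - const d * quad_rep w \<in> C2quad k"
    using assms by (auto simp: quad_rep_mod_C2_def)
  from C2quad.add[OF this] have "p + q - const (c + d) * quad_rep w \<in> C2quad k"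
    by (simp add: const_add algebra_simps)
  then show ?thesis unfolding quad_rep_mod_C2_def by blast
qed

lemma quad_rep_mod_C2_const_mult:
  assumes "p \<in> quad_rep_mod_C2 k w"
  shows "const c * p \<in> quad_rep_mod_C2 k w"
proof -
  obtain d where "p - const d * quad_rep w \<in> C2quad k"
    using assms by (auto simp: quad_rep_mod_C2_def)
  from C2quad.scale[OF this, of c] have "const c * p - const (c * d) * quad_rep w \<in> C2quad k"
    by (simp add: const_mult right_diff_distrib mult.assoc)
  then show ?thesis unfolding quad_rep_mod_C2_def by blast
qed

lemma quad_rep_mod_C2_of_nat_mult: "p \<in> quad_rep_mod_C2 k w \<Longrightarrow> of_nat n * p \<in> quad_rep_mod_C2 k w"
  using quad_rep_mod_C2_const_mult[of p k w "of_nat n"] by simp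

lemma quad_rep_mod_C2_diff: "p \<in> quad_rep_mod_C2 k w \<Longrightarrow> q \<in> quad_rep_mod_C2 k w \<Longrightarrow> p - q \<in> quad_rep_mod_C2 k w"
  using quad_rep_mod_C2_add[of p k w "const (-1) * q"] quad_rep_mod_C2_const_mult[of q k w "-1"] by (simp add: single_uminus)

lemma quad_rep_mod_C2_cancel_of_nat: "of_nat n * p \<in> quad_rep_mod_C2 k w \<Longrightarrow> n > 0 \<Longrightarrow> p \<in> quad_rep_mod_C2 k w"
  using quad_rep_mod_C2_const_mult[of "of_nat n * p" k w "inverse (of_nat n)"] const_inverse_mult[of "of_nat n" p]
  by simp

text \<open>Weight is shifted until the monomial contains \<open>X 1 * X 2\<close>, which vanishes to leading
  order; all corrections are shorter monomials with an index of at least 2.\<close>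

lemma quad_rep_mod_C2_monomial:
  assumes "0 \<notin># P" "even (size P)" "P \<noteq> {#}" "size P = 2 \<or> (\<exists>c\<in>#P. c \<ge> 2)"
  shows "mon P \<in> quad_rep_mod_C2 k (\<Sum>\<^sub># P)"
  using assms
proof (induction "size P" arbitrary: P rule: less_induct)
  case less
  \<comment> \<open>Each term replaces one part \<open>q\<close> of \<open>U\<close> by
    \<open>N + q\<close>. The size stays that of \<open>U\<close>, hence below that of
    \<open>P\<close>, and the new part is at least 2, so the induction hypothesis applies.\<close>
  have corr: "der (qder k N g) (mon U) \<in> quad_rep_mod_C2 k (N + \<Sum>\<^sub># U)"
    if U: "0 \<notin># U" "even (size U)" "size U < size P" and N: "N \<ge> 2" for U N g
  proof -
    have "(\<Sum>q\<in>#M. qder k N g q * mon (U - {#q#})) \<in> quad_rep_mod_C2 k (N + \<Sum>\<^sub># U)" if "M \<subseteq># U" for M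
      using that
    proof (induction M)
      case empty
      show ?case by (simp add: quad_rep_mod_C2_K C2quad.zero)
    next
      case (add q M)
      have q: "q \<in># U" and M: "M \<subseteq># U"
        using mset_subset_eq_insertD[OF add.prems] by (auto simp: subset_mset.less_imp_le)
      obtain U' where U': "U = add_mset q U'" using mset_add[OF q] by blast
      have "mon (add_mset (N + q) U') \<in> quad_rep_mod_C2 k (\<Sum>\<^sub># (add_mset (N + q) U'))"
        by (rule less.hyps) (use U N in \<open>auto simp: U'\<close>)
      then have "const c * (X (N + q) * mon U') \<in> quad_rep_mod_C2 k (N + \<Sum>\<^sub># U)" for c
        by (intro quad_rep_mod_C2_const_mult) (simp add: U' mon_add_mset add.assoc)
      then have "qder k N g q * mon (U - {#q#}) \<in> quad_rep_mod_C2 k (N + \<Sum>\<^sub># U)"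
        by (simp add: qder_def U' mult.assoc)
      then show ?case using add.IH[OF M] by (simp add: quad_rep_mod_C2_add)
    qed
    then show ?thesis by (simp add: der_mon dmon_def)
  qed
  have rel: "of_nat a * mon (U + {#a + 1, b#}) + of_nat b * mon (U + {#a, b + 1#})
      \<in> quad_rep_mod_C2 k (a + b + 1 + \<Sum>\<^sub># U)"
    if U: "0 \<notin># U" "even (size U)" "size U < size P" and ab: "a \<ge> 1" "b \<ge> 1" for U a b
  proof -
    have "(of_nat a * (X (a + 1) * X b) + of_nat b * (X a * X (b + 1))) * mon U
      + der (qder k (a + b + 1) (bfun (a + b + 1) a b)) (mon U) \<in> quad_rep_mod_C2 k (a + b + 1 + \<Sum>\<^sub># U)"
      using U ab by (intro quad_rep_mod_C2_K C2quad_shift) auto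
    from quad_rep_mod_C2_diff[OF this corr[OF U, of "a + b + 1" "bfun (a + b + 1) a b"]] ab
    have "(of_nat a * (X (a + 1) * X b) + of_nat b * (X a * X (b + 1))) * mon U
        \<in> quad_rep_mod_C2 k (a + b + 1 + \<Sum>\<^sub># U)" by simp
    then show ?thesis by (simp add: mon_add_mset distrib_right mult.assoc)
  qed
  have step: "mon (U + {#a + 1, b#}) \<in> quad_rep_mod_C2 k w \<longleftrightarrow> mon (U + {#a, b + 1#}) \<in> quad_rep_mod_C2 k w"
    if U: "0 \<notin># U" "even (size U)" "size U < size P" and ab: "a \<ge> 1" "b \<ge> 1"
      and w: "w = a + b + 1 + \<Sum>\<^sub># U" for U a b w
  proof
    note r = rel[OF U ab, folded w]
    assume "mon (U + {#a + 1, b#}) \<in> quad_rep_mod_C2 k w"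
    from quad_rep_mod_C2_diff[OF r quad_rep_mod_C2_of_nat_mult[OF this, of a]]
    have "of_nat b * mon (U + {#a, b + 1#}) \<in> quad_rep_mod_C2 k w" by (simp only: add_diff_cancel_left')
    then show "mon (U + {#a, b + 1#}) \<in> quad_rep_mod_C2 k w" by (rule quad_rep_mod_C2_cancel_of_nat) (use ab in simp)
  next
    note r = rel[OF U ab, folded w]
    assume "mon (U + {#a, b + 1#}) \<in> quad_rep_mod_C2 k w"
    from quad_rep_mod_C2_diff[OF r quad_rep_mod_C2_of_nat_mult[OF this, of b]]
    have "of_nat a * mon (U + {#a + 1, b#}) \<in> quad_rep_mod_C2 k w" by (simp only: add_diff_cancel_right')
    then show "mon (U + {#a + 1, b#}) \<in> quad_rep_mod_C2 k w" by (rule quad_rep_mod_C2_cancel_of_nat) (use ab in simp)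
  qed
  have to1: "mon (U + {#a, b#}) \<in> quad_rep_mod_C2 k w \<longleftrightarrow> mon (U + {#1, a + b - 1#}) \<in> quad_rep_mod_C2 k w"
    if U: "0 \<notin># U" "even (size U)" "size U < size P" and ab: "a \<ge> 1" "b \<ge> 1"
      and w: "w = a + b + \<Sum>\<^sub># U" for U a b w
    using ab w
  proof (induction a arbitrary: b rule: nat_induct_at_least)
    case (Suc a)
    then show ?case using step[OF U, of a b w] Suc.IH[of "b + 1"] by simp
  qed simp
  \<comment> \<open>Both pairs reduce to the same pair with entry 1, so two parts may be exchanged
    for any two positive parts with the same sum.\<close>
  have shift: "mon (U + {#a, b#}) \<in> quad_rep_mod_C2 k w"
    if U: "0 \<notin># U" "even (size U)" "size U < size P" and ab: "a \<ge> 1" "b \<ge> 1"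
      and w: "w = a + b + \<Sum>\<^sub># U" and cd: "c \<ge> 1" "d \<ge> 1" "a + b = c + d"
      and "mon (U + {#c, d#}) \<in> quad_rep_mod_C2 k w" for U a b c d w
    using to1[OF U ab w] to1[OF U cd(1,2), of w] that by simp
  obtain c P1 where P1: "P = add_mset c P1" and c: "size P = 2 \<or> c \<ge> 2"
    using less.prems by (metis multi_member_split multiset_cases)
  have c0: "c \<ge> 1" using less.prems by (auto simp: P1 Suc_le_eq intro: gr0I)
  have "P1 \<noteq> {#}" using less.prems by (auto simp: P1)
  then obtain b P2 where P2: "P1 = add_mset b P2" by (metis multiset_cases)
  have b0: "b \<ge> 1" using less.prems by (auto simp: P1 P2 Suc_le_eq intro: gr0I)
  show ?case
  proof (cases "P2 = {#}")
    case True
    have "mon ({#} + {#1, c + b - 1#}) \<in> quad_rep_mod_C2 k (c + b)"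
      using quad_rep_mod_C2_Y[of "c + b" k] by (simp add: quad_rep_def mon_add_mset)
    then show ?thesis using to1[of "{#}" c b "c + b"] c0 b0 by (simp add: P1 P2 True)
  next
    case False
    then obtain d V where V: "P2 = add_mset d V" by (metis multiset_cases)
    have d0: "d \<ge> 1" using less.prems by (auto simp: P1 P2 V Suc_le_eq intro: gr0I)
    have "V \<noteq> {#}" using less.prems by (auto simp: P1 P2 V)
    then have "size V \<noteq> 0" by simp
    then have c: "c \<ge> 2" using c by (auto simp: P1 P2 V)
    define w where "w = \<Sum>\<^sub># P"
    have V0: "0 \<notin># V" "odd (size V)" using less.prems by (auto simp: P1 P2 V)
    have weq: "1 + 1 + 1 + \<Sum>\<^sub># (add_mset (c + b + d - 3) V) = w"
      using c b0 d0 by (simp add: w_def P1 P2 V)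
    \<comment> \<open>For \<open>a = b = 1\<close> both leading terms of the shift relation are
      \<open>X 1 * X 2\<close>. The third part \<open>c + b + d - 3\<close> keeps the total weight,
      and \<open>c \<ge> 2\<close> makes it positive.\<close>
    have "of_nat 1 * mon (add_mset (c + b + d - 3) V + {#1 + 1, 1#})
        + of_nat 1 * mon (add_mset (c + b + d - 3) V + {#1, 1 + 1#})
        \<in> quad_rep_mod_C2 k (1 + 1 + 1 + \<Sum>\<^sub># (add_mset (c + b + d - 3) V))"
      using V0 c b0 d0 by (intro rel) (auto simp: P1 P2 V)
    then have "of_nat 2 * mon (add_mset 1 V + {#2, c + b + d - 3#}) \<in> quad_rep_mod_C2 k w"
      unfolding weq by (simp add: add_mset_commute numeral_2_eq_2)
    then have "mon (add_mset 1 V + {#2, c + b + d - 3#}) \<in> quad_rep_mod_C2 k w"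
      by (rule quad_rep_mod_C2_cancel_of_nat) simp
    \<comment> \<open>The parts 1, 2 and \<open>c + b + d - 3\<close> are turned into
      \<open>c\<close>, \<open>b\<close>, \<open>d\<close> by two exchanges: with 1 as spectator to
      reach \<open>d\<close>, then with \<open>d\<close> as spectator.\<close>
    then have "mon (add_mset 1 V + {#d, c + b - 1#}) \<in> quad_rep_mod_C2 k w"
      using V0 c b0 d0 by (intro shift[of "add_mset 1 V" d "c + b - 1" w 2 "c + b + d - 3"])
        (auto simp: w_def P1 P2 V)
    then have "mon (add_mset d V + {#1, c + b - 1#}) \<in> quad_rep_mod_C2 k w"
      by (simp add: add_mset_commute)
    then have "mon (add_mset d V + {#c, b#}) \<in> quad_rep_mod_C2 k w"
      using V0 c b0 d0 by (intro shift[of "add_mset d V" c b w 1 "c + b - 1"])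
        (auto simp: w_def P1 P2 V)
    then show ?thesis by (simp add: w_def P1 P2 V add_mset_commute)
  qed
qed

text \<open>In odd weight \<open>2 * j + 1\<close> the shift relation with \<open>a = b = j\<close>
  has two equal terms, so the middle monomial \<open>X (j + 1) * X j\<close> vanishes. Shifting
  outwards carries this to \<open>X 1 * X (2 * j)\<close>.\<close>

lemma quad_rep_odd:
  assumes "odd w" "w > 1"
  shows "quad_rep w \<in> C2quad k"
proof -
  from assms(1) obtain j where w: "w = 2 * j + 1" by (rule oddE)
  have j: "j \<ge> 1" using assms(2) w by simp
  have "X (j - i + 1) * X (j + i) \<in> C2quad k" if "i \<le> j" for i
    using that
  proof (induction i)
    case 0
    have "of_nat (2 * j) * (X (j + 1) * X j) \<in> C2quad k"
      using C2quad_shift_1[of j j k] j by (simp add: algebra_simps)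
    from C2quad_cancel_of_nat[OF this] show ?case using j by simp
  next
    case (Suc i)
    have "of_nat (j - i) * (X (j - i + 1) * X (j + i)) \<in> C2quad k"
      using Suc by (intro C2quad_of_nat_mult) simp
    moreover have "of_nat (j - i) * (X (j - i + 1) * X (j + i))
        + of_nat (j + i) * (X (j - i) * X (j + i + 1)) \<in> C2quad k"
      using Suc.prems j by (intro C2quad_shift_1) auto
    ultimately have "of_nat (j + i) * (X (j - i) * X (j + i + 1)) \<in> C2quad k"
      using C2quad_diff by fastforce
    from C2quad_cancel_of_nat[OF this] have "X (j - i) * X (j + i + 1) \<in> C2quad k" using j by simp
    then show ?case using Suc.prems by (simp add: Suc_diff_Suc)
  qed
  from this[of j] show ?thesis by (simp add: quad_rep_def w mult_2)
qed

section \<open>Explicit scalars, including the quantum corrections\<close>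

lemma C2quad_X3: "of_nat 2 * (X 3 * X n) - of_nat (n * (n + 1)) * (X 1 * X (n + 2)) \<in> C2quad k" if "n \<ge> 1"
proof -
  have 1: "of_nat 2 * (X 3 * X n) + of_nat n * (X 2 * X (n + 1)) \<in> C2quad k"
    using C2quad_shift_1[of 2 n k] that by (simp add: numeral_eq_Suc)
  have 2: "X 2 * X (n + 1) + of_nat (n + 1) * (X 1 * X (n + 2)) \<in> C2quad k"
    using C2quad_shift_1[of 1 "n + 1" k] that by (simp add: numeral_eq_Suc)
  show ?thesis
    using C2quad_diff[OF 1 C2quad_of_nat_mult[OF 2, of n]] by (simp add: algebra_simps)
qed

text \<open>Iterated shifts reduce \<open>X (r + 1) * X n\<close> to \<open>(-1)^r\<close> times the
  binomial coefficient of \<open>n + r - 1\<close> over \<open>r\<close>, times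
  \<open>X 1 * X (n + r)\<close>. This is \<open>r = 3\<close>, and \<open>C2quad_X3\<close> is
  \<open>r = 2\<close>, both with denominators cleared.\<close>

lemma C2quad_X4: "of_nat 6 * (X 4 * X n) + of_nat (n * (n + 1) * (n + 2)) * (X 1 * X (n + 3)) \<in> C2quad k"
  if "n \<ge> 1"
proof -
  have 1: "of_nat 3 * (X 4 * X n) + of_nat n * (X 3 * X (n + 1)) \<in> C2quad k"
    using C2quad_shift_1[of 3 n k] that by (simp add: numeral_eq_Suc)
  have 2: "of_nat 2 * (X 3 * X (n + 1)) - of_nat ((n + 1) * (n + 2)) * (X 1 * X (n + 3)) \<in> C2quad k"
    using C2quad_X3[of "n + 1" k] by (simp add: numeral_eq_Suc)
  show ?thesis
    using C2quad_diff[OF C2quad_of_nat_mult[OF 1, of 2] C2quad_of_nat_mult[OF 2, of n]] by (simp add: algebra_simps)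
qed

text \<open>For \<open>a = 1\<close> the first binomial of \<open>bfun\<close> is 1. The second is
  the binomial coefficient of \<open>m + 2\<close> over 3 at \<open>z = -1\<close>, and that of -2
  over \<open>m - 1\<close> at \<open>z = m + 3\<close>; the latter equals \<open>-m\<close> because
  \<open>m\<close> is even.\<close>

lemma qder_bfun_1:
  assumes "m \<ge> 1" "even m"
  shows "of_nat 6 * qder k (m + 2) (bfun (m + 2) 1 m) 1
    = of_nat (2 * k) * (of_nat (m * (m + 1) * (m + 2)) - of_nat (6 * m)) * X (m + 3)"
proof -
  have 1: "(of_nat (m + 2) - 1 - (- of_nat 1) gchoose (m - 1)) = (of_nat (m + 2 choose 3) :: complex)"
  proof -
    have "(of_nat (m + 2) - 1 - (- of_nat 1) :: complex) = of_nat (m + 2)" by simp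
    moreover have "(m + 2 choose (m - 1)) = (m + 2 choose 3)"
      using binomial_symmetric[of 3 "m + 2"] assms by simp
    ultimately show ?thesis by (simp only: binomial_gbinomial[symmetric])
  qed
  have "(of_nat (m + 2) - 1 - of_nat (m + 2 + 1) :: complex) = - 2" by simp
  moreover have "((- 2 :: complex) gchoose (m - 1)) = (- 1) ^ (m - 1) * (of_nat m gchoose (m - 1))"
    using gbinomial_minus[of "2::complex" "m - 1"] assms by (simp add: of_nat_diff)
  moreover have "(of_nat m gchoose (m - 1)) = (of_nat m :: complex)"
    using assms binomial_symmetric[of 1 m] by (simp add: binomial_gbinomial[symmetric])
  moreover have "(- 1 :: complex) ^ (m - 1) = - 1" using assms by simp
  ultimately have 2: "(of_nat (m + 2) - 1 - of_nat (m + 2 + 1) gchoose (m - 1)) = - (of_nat m :: complex)"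
    by simp
  have "6 * (m + 2 choose 3) = m * (m + 1) * (m + 2)"
  proof -
    have "3 * (m + 2 choose 3) = (m + 2) * (m + 1 choose 2)"
      using Suc_times_binomial_eq[of "m + 1" 2] by (simp add: numeral_eq_Suc)
    moreover have "2 * (m + 1 choose 2) = (m + 1) * m"
      using Suc_times_binomial_eq[of m 1] by (simp add: numeral_eq_Suc)
    ultimately have "2 * (3 * (m + 2 choose 3)) = (m + 2) * ((m + 1) * m)" by simp
    then show ?thesis by (simp add: ac_simps)
  qed
  then have 3: "(6 * of_nat (m + 2 choose 3) :: complex) = of_nat (m * (m + 1) * (m + 2))"
    by (metis of_nat_mult of_nat_numeral)
  have "const (of_nat 6) * qder k (m + 2) (bfun (m + 2) 1 m) 1
    = const (of_nat (2 * k) * (6 * of_nat (m + 2 choose 3) - of_nat (6 * m))) * X (m + 3)"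
    unfolding qder_def bfun_def 1 2 mult.assoc[symmetric] const_mult[symmetric]
    by (rule arg_cong2[of _ _ _ _ "\<lambda>c n. const c * X n"])
      (simp_all add: algebra_simps)
  then show ?thesis unfolding 3 const_mult single_diff single_of_nat by (simp only: mult.assoc)
qed

lemma der_X1_X1: "der (qder k N g) (X 1 * X 1) = of_nat 2 * qder k N g 1 * X 1"
  by (simp add: der_mult algebra_simps)

text \<open>The degree four monomial is first moved to \<open>X 1 * X 1 * X 2 * X (n - 1)\<close>,
  then killed by \<open>X 1 * X 2\<close>; only quantum corrections survive.\<close>

lemma C2quad_X1_cubed:
  assumes "n \<ge> 3" "odd n"
  shows "X 1 * X 1 * X 1 * X n + of_nat k * (of_nat (n * (n + 1)) - 6) * (X 1 * X (n + 2)) \<in> C2quad k"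
proof -
  define m where "m = n - 1"
  have m: "n = m + 1" "m \<ge> 2" "m \<ge> 1" "even m" using assms by (auto simp: m_def)
  define c :: heis_poly where "c = of_nat (m * (m + 1) * (m + 2)) - of_nat (6 * m)"
  define y where "y = X 1 * X (m + 3)"
  \<comment> \<open>The shift relation with \<open>a = 1\<close>, \<open>b = m\<close> and spectator
    \<open>X 1 * X 1\<close> trades \<open>X 1 * X 1 * X 1 * X n\<close> for a monomial containing
    \<open>X 1 * X 2\<close>.\<close>
  have A: "(X 2 * X m + of_nat m * (X 1 * X (m + 1))) * (X 1 * X 1)
      + der (qder k (m + 2) (bfun (m + 2) 1 m)) (X 1 * X 1) \<in> C2quad k"
    using C2quad_shift[of 1 m "X 1 * X 1" k] m parity_mult_XX[of 1 False 1 1]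
    by (simp add: numeral_eq_Suc)
  have A': "of_nat 6 * ((X 2 * X m + of_nat m * (X 1 * X (m + 1))) * (X 1 * X 1))
      + of_nat (4 * k) * c * y \<in> C2quad k"
  proof -
    have "of_nat 6 * der (qder k (m + 2) (bfun (m + 2) 1 m)) (X 1 * X 1)
        = of_nat 2 * (of_nat 6 * qder k (m + 2) (bfun (m + 2) 1 m) 1) * X 1"
      unfolding der_X1_X1 by (simp only: ac_simps)
    also have "\<dots> = of_nat (4 * k) * c * y"
      unfolding qder_bfun_1[OF m(3,4)] c_def y_def by (simp add: algebra_simps)
    finally show ?thesis
      using C2quad_of_nat_mult[OF A, of 6] by (simp only: distrib_left[of "of_nat 6" "U * V" for U V] mult.assoc)
  qed
  \<comment> \<open>Here \<open>bfun 3 1 1\<close> is constantly 1, so the correction sends each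
    \<open>X q\<close> to \<open>4kq\<close> times \<open>X (q + 3)\<close>.\<close>
  have B: "of_nat 2 * (X 1 * X 2) * (X 1 * X m) + of_nat (4 * k) * (X 4 * X m + of_nat m * y) \<in> C2quad k"
  proof -
    have *: "qder k 3 (bfun 3 1 1) q = of_nat (4 * k * q) * X (q + 3)" for q
      unfolding qder_def single_of_nat[symmetric]
      by (rule arg_cong2[of _ _ _ _ "\<lambda>c n. const c * X n"]) (simp_all add: bfun_def)
    have "(X 2 * X 1 + X 1 * X 2) * (X 1 * X m) + der (qder k 3 (bfun 3 1 1)) (X 1 * X m) \<in> C2quad k"
      using C2quad_shift[of 1 1 "X 1 * X m" k] m parity_mult_XX[of 1 False 1 m]
      by (simp add: numeral_eq_Suc)
    moreover have "der (qder k 3 (bfun 3 1 1)) (X 1 * X m)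
        = of_nat (4 * k) * (X 4 * X m + of_nat m * y)"
      unfolding der_mult der_X * y_def by (simp add: algebra_simps)
    ultimately show ?thesis by (simp add: algebra_simps)
  qed
  have C: "of_nat 6 * (X 4 * X m) + of_nat (m * (m + 1) * (m + 2)) * y \<in> C2quad k"
    using C2quad_X4[of m k] m by (simp add: y_def)
  \<comment> \<open>In \<open>A' - 3 B + 2k C\<close> the terms with
    \<open>X 1 * X 1 * X 2 * X m\<close> and with \<open>X 4 * X m\<close> cancel, and the
    coefficients of \<open>y\<close> add up to \<open>6kc\<close>. As \<open>c\<close> equals
    \<open>m\<close> times \<open>n(n+1) - 6\<close>, the common factor \<open>6m\<close> can be
    divided out.\<close>
  have "of_nat (6 * m) * (X 1 * X 1 * X 1 * X n) + of_nat (6 * k) * c * y \<in> C2quad k"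
    using C2quad.add[OF C2quad_diff[OF A' C2quad_of_nat_mult[OF B, of 3]] C2quad_of_nat_mult[OF C, of "2 * k"]]
    by (simp add: c_def m(1) algebra_simps)
  moreover have "of_nat (6 * m) * (X 1 * X 1 * X 1 * X n) + of_nat (6 * k) * c * y
     = of_nat (6 * m) * (X 1 * X 1 * X 1 * X n + of_nat k * (of_nat (n * (n + 1)) - 6) * (X 1 * X (n + 2)))"
    by (simp add: c_def m(1) y_def numeral_eq_Suc algebra_simps)
  ultimately have "of_nat (6 * m) * (X 1 * X 1 * X 1 * X n
      + of_nat k * (of_nat (n * (n + 1)) - 6) * (X 1 * X (n + 2))) \<in> C2quad k"
    by (simp only:)
  then show ?thesis by (rule C2quad_cancel_of_nat) (use m in simp)
qed

text \<open>Three contributions add up to \<open>(n+2)(n+3)/4\<close>: \<open>-(n(n+1)-6)/4\<close>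
  from \<open>X 1 * X 1 * X 1 * X n\<close> divided by \<open>4k\<close>, \<open>n(n+1)/2\<close>
  from \<open>X 3 * X n\<close>, and \<open>n\<close> from \<open>X 1 * X (n + 2)\<close>.\<close>

lemma Lm2_op_quad_rep:
  assumes "k > 0" "n \<ge> 3" "odd n"
  shows "of_nat 4 * Lm2_op k (X 1 * X n) - of_nat ((n + 2) * (n + 3)) * (X 1 * X (n + 2)) \<in> C2quad k"
proof -
  define x where "x = X 1 * X 1 * X 1 * X n"
  have "of_nat (4 * k) * Lm2_op k (X 1 * X n)
     = const (of_nat (4 * k) * (1 / of_nat (4 * k))) * x
       + of_nat (4 * k) * (X 3 * X n + of_nat n * (X 1 * X (n + 2)))"
    unfolding const_mult single_of_nat Lm2_op_eq[OF assms(1)] der_mult der_X x_def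
    by (simp add: numeral_eq_Suc algebra_simps)
  then have L: "of_nat (4 * k) * Lm2_op k (X 1 * X n)
     = x + of_nat (4 * k) * (X 3 * X n + of_nat n * (X 1 * X (n + 2)))"
    using assms(1) by simp
  have "of_nat k * (of_nat 4 * Lm2_op k (X 1 * X n) - of_nat ((n + 2) * (n + 3)) * (X 1 * X (n + 2)))
    = (x + of_nat k * (of_nat (n * (n + 1)) - 6) * (X 1 * X (n + 2)))
      + of_nat (2 * k) * (of_nat 2 * (X 3 * X n) - of_nat (n * (n + 1)) * (X 1 * X (n + 2)))"
    (is "?l = ?r")
  proof -
    have "?l = of_nat (4 * k) * Lm2_op k (X 1 * X n) - of_nat k * of_nat ((n + 2) * (n + 3)) * (X 1 * X (n + 2))"
      by (simp add: algebra_simps)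
    also have "\<dots> = ?r" unfolding L by (simp add: algebra_simps)
    finally show ?thesis .
  qed
  moreover have "?r \<in> C2quad k"
    unfolding x_def using assms by (intro C2quad.add C2quad_of_nat_mult C2quad_X1_cubed C2quad_X3) auto
  ultimately show ?thesis using assms(1) C2quad_cancel_of_nat by metis
qed

section \<open>Spanning by \<open>L(-2)\<close>-towers over the vacuum and \<open>J\<close>\<close>

definition Jpoly :: "nat \<Rightarrow> heis_poly" where
  "Jpoly k = const (1 / of_nat (4 * k ^ 2)) * mon {#1, 1, 1, 1#} - const (1 / of_nat k) * mon {#3, 1#}
    + const (3 / of_nat (4 * k)) * mon {#2, 2#}"

text \<open>The towers for \<open>t = 0\<close> and \<open>t = 1\<close>, the second because
  \<open>J_{-1} 1 = J\<close>; their span is stable under \<open>L(-2)\<close> by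
  construction.\<close>

inductive_set LJspan :: "nat \<Rightarrow> heis_poly set" for k where
  zero: "0 \<in> LJspan k"
| add: "p \<in> LJspan k \<Longrightarrow> q \<in> LJspan k \<Longrightarrow> p + q \<in> LJspan k"
| scale: "p \<in> LJspan k \<Longrightarrow> const c * p \<in> LJspan k"
| one: "(Lm2_op k ^^ s) 1 \<in> LJspan k"
| J: "(Lm2_op k ^^ s) (Jpoly k) \<in> LJspan k"

lemma LJspan_Lm2_op: "p \<in> LJspan k \<Longrightarrow> Lm2_op k p \<in> LJspan k"
proof (induction rule: LJspan.induct)
  case zero
  then show ?case by (simp add: Lm2_op_def LJspan.zero)
next
  case (one s)
  show ?case using LJspan.one[of "Suc s" k] by simp
next
  case (J s)
  show ?case using LJspan.J[of "Suc s" k] by simp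
qed (simp_all add: Lm2_op_add Lm2_op_const_mult LJspan.add LJspan.scale)

definition LJ_mod_C2 :: "nat \<Rightarrow> heis_poly set" where
  "LJ_mod_C2 k = {p. \<exists>s\<in>LJspan k. p - s \<in> C2quad k}"

lemma LJ_mod_C2_Sp: "p \<in> LJspan k \<Longrightarrow> p \<in> LJ_mod_C2 k"
  unfolding LJ_mod_C2_def using C2quad.zero by force

lemma LJ_mod_C2_K: "p \<in> C2quad k \<Longrightarrow> p \<in> LJ_mod_C2 k"
  unfolding LJ_mod_C2_def using LJspan.zero by force

lemma LJ_mod_C2_add: "p \<in> LJ_mod_C2 k \<Longrightarrow> q \<in> LJ_mod_C2 k \<Longrightarrow> p + q \<in> LJ_mod_C2 k"
  unfolding LJ_mod_C2_def by (clarsimp, metis LJspan.add C2quad.add add_diff_add)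

lemma LJ_mod_C2_const_mult: "p \<in> LJ_mod_C2 k \<Longrightarrow> const c * p \<in> LJ_mod_C2 k"
  unfolding LJ_mod_C2_def by (clarsimp, metis LJspan.scale C2quad.scale right_diff_distrib)

lemma LJ_mod_C2_of_nat_mult: "p \<in> LJ_mod_C2 k \<Longrightarrow> of_nat n * p \<in> LJ_mod_C2 k"
  using LJ_mod_C2_const_mult[of p k "of_nat n"] by simp

lemma LJ_mod_C2_diff: "p \<in> LJ_mod_C2 k \<Longrightarrow> q \<in> LJ_mod_C2 k \<Longrightarrow> p - q \<in> LJ_mod_C2 k"
  using LJ_mod_C2_add[of p k "const (-1) * q"] LJ_mod_C2_const_mult[of q k "-1"] by (simp add: single_uminus)

lemma LJ_mod_C2_cancel_of_nat: "of_nat n * p \<in> LJ_mod_C2 k \<Longrightarrow> n > 0 \<Longrightarrow> p \<in> LJ_mod_C2 k"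
  using LJ_mod_C2_const_mult[of "of_nat n * p" k "inverse (of_nat n)"] const_inverse_mult[of "of_nat n" p]
  by simp

lemma LJ_mod_C2_Lop: "k > 0 \<Longrightarrow> p \<in> LJ_mod_C2 k \<Longrightarrow> Lm2_op k p \<in> LJ_mod_C2 k"
proof -
  assume k: "k > 0" and "p \<in> LJ_mod_C2 k"
  then obtain s where s: "s \<in> LJspan k" "p - s \<in> C2quad k" by (auto simp: LJ_mod_C2_def)
  have "Lm2_op k p = Lm2_op k s + Lm2_op k (p - s)" using Lm2_op_add[of k s "p - s"] by simp
  then show ?thesis using LJspan_Lm2_op[OF s(1)] C2quad_Lm2_op[OF k s(2)] by (simp add: LJ_mod_C2_add LJ_mod_C2_Sp LJ_mod_C2_K)
qed

lemma LJ_mod_C2_Z: "quad_rep w \<in> LJ_mod_C2 k \<Longrightarrow> p \<in> quad_rep_mod_C2 k w \<Longrightarrow> p \<in> LJ_mod_C2 k"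
  unfolding quad_rep_mod_C2_def by clarsimp (metis LJ_mod_C2_K LJ_mod_C2_add LJ_mod_C2_const_mult diff_add_cancel)

lemma X1_power: "X 1 ^ n = mon (replicate_mset n 1)"
  by (induction n) (simp_all add: mon_add_mset)

lemma der_power_X1: "der d (X 1 ^ n) = of_nat n * d 1 * X 1 ^ (n - 1)"
proof (induction n)
  case (Suc n)
  then show ?case by (cases n) (simp_all add: der_mult algebra_simps)
qed simp

lemma Lm2_op_X1_power:
  assumes "k > 0"
  shows "of_nat (4 * k) * Lm2_op k (X 1 ^ n)
    = X 1 ^ (n + 2) + of_nat (4 * k * n) * (X 3 * X 1 ^ (n - 1))"
proof -
  have "of_nat (4 * k) * Lm2_op k (X 1 ^ n) = const (of_nat (4 * k) * (1 / of_nat (4 * k))) * X 1 ^ (n + 2)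
      + of_nat (4 * k * n) * (X 3 * X 1 ^ (n - 1))"
    unfolding const_mult single_of_nat Lm2_op_eq[OF assms] der_power_X1
    by (simp add: numeral_eq_Suc algebra_simps)
  then show ?thesis using assms by simp
qed

lemma LJ_mod_C2_one: "1 \<in> LJ_mod_C2 k"
  using LJspan.one[of 0 k] by (simp add: LJ_mod_C2_Sp)

lemma LJ_mod_C2_X1_squared:
  assumes "k > 0"
  shows "X 1 ^ 2 \<in> LJ_mod_C2 k"
  using LJ_mod_C2_of_nat_mult[OF LJ_mod_C2_Lop[OF assms LJ_mod_C2_one], of "4 * k"] Lm2_op_X1_power[OF assms, of 0]
  by (simp add: power2_eq_square)

text \<open>Write \<open>x\<close> for \<open>X 1 * X 3\<close>. Applying \<open>4k L(-2)\<close> to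
  \<open>X 1 ^ 2\<close> gives \<open>X 1 ^ 4 + 8k x\<close>, while \<open>4k^2 J\<close> becomes
  \<open>X 1 ^ 4 - 10k x\<close>, since \<open>X 2 * X 2\<close> reduces to \<open>-2x\<close>. The
  difference \<open>18k x\<close> isolates \<open>x\<close>.\<close>

lemma LJ_mod_C2_base:
  assumes "k > 0"
  shows "X 1 ^ 4 \<in> LJ_mod_C2 k \<and> quad_rep 4 \<in> LJ_mod_C2 k"
proof -
  define x where "x = X 1 * X 3"
  have 1: "X 1 ^ 4 + of_nat (8 * k) * x \<in> LJ_mod_C2 k"
    using LJ_mod_C2_of_nat_mult[OF LJ_mod_C2_Lop[OF assms LJ_mod_C2_X1_squared[OF assms]], of "4 * k"]
    unfolding Lm2_op_X1_power[OF assms] by (simp add: x_def mult.commute)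
  have "X 2 * X 2 + of_nat 2 * x \<in> LJ_mod_C2 k"
    using C2quad_shift_1[of 1 2 k] by (intro LJ_mod_C2_K) (simp add: x_def numeral_eq_Suc)
  then have 2: "of_nat (3 * k) * (X 2 * X 2 + of_nat 2 * x) \<in> LJ_mod_C2 k" by (rule LJ_mod_C2_of_nat_mult)
  have J: "of_nat (4 * k ^ 2) * Jpoly k = X 1 ^ 4 - of_nat (4 * k) * x + of_nat (3 * k) * (X 2 * X 2)"
  proof -
    have "of_nat (4 * k ^ 2) * Jpoly k = const (of_nat (4 * k ^ 2) * (1 / of_nat (4 * k ^ 2))) * mon {#1, 1, 1, 1#}
      - const (of_nat (4 * k ^ 2) * (1 / of_nat k)) * mon {#3, 1#}
      + const (of_nat (4 * k ^ 2) * (3 / of_nat (4 * k))) * mon {#2, 2#}"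
      unfolding const_mult single_of_nat Jpoly_def by (simp only: distrib_left right_diff_distrib mult.assoc)
    moreover have "of_nat (4 * k ^ 2) * (1 / of_nat (4 * k ^ 2)) = (of_nat 1 :: complex)"
      "of_nat (4 * k ^ 2) * (1 / of_nat k) = (of_nat (4 * k) :: complex)"
      "of_nat (4 * k ^ 2) * (3 / of_nat (4 * k)) = (of_nat (3 * k) :: complex)"
      using assms by (simp_all add: power2_eq_square)
    moreover have "mon {#1, 1, 1, 1#} = X 1 ^ 4" "mon {#3, 1#} = x" "mon {#2, 2#} = X 2 * X 2"
      by (simp_all add: mon_add_mset x_def numeral_eq_Suc)
    ultimately show ?thesis by (simp only: single_of_nat) simp
  qed
  have "of_nat (4 * k ^ 2) * Jpoly k \<in> LJ_mod_C2 k"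
    using LJspan.J[of 0 k] by (intro LJ_mod_C2_of_nat_mult LJ_mod_C2_Sp) simp
  then have 3: "X 1 ^ 4 - of_nat (4 * k) * x + of_nat (3 * k) * (X 2 * X 2) \<in> LJ_mod_C2 k"
    unfolding J .
  have "of_nat (18 * k) * x = (X 1 ^ 4 + of_nat (8 * k) * x)
      - ((X 1 ^ 4 - of_nat (4 * k) * x + of_nat (3 * k) * (X 2 * X 2))
        - of_nat (3 * k) * (X 2 * X 2 + of_nat 2 * x))"
    by (simp add: algebra_simps)
  then have "of_nat (18 * k) * x \<in> LJ_mod_C2 k" using LJ_mod_C2_diff[OF 1 LJ_mod_C2_diff[OF 3 2]] by (simp only:)
  then have x: "x \<in> LJ_mod_C2 k" by (rule LJ_mod_C2_cancel_of_nat) (use assms in simp)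
  have "X 1 ^ 4 \<in> LJ_mod_C2 k" using LJ_mod_C2_diff[OF 1 LJ_mod_C2_of_nat_mult[OF x, of "8 * k"]] by simp
  then show ?thesis using x by (simp add: quad_rep_def x_def)
qed

text \<open>The two families climb together. \<open>L(-2)\<close> takes
  \<open>quad_rep (2 * t)\<close> to a nonzero multiple of the next one, and takes
  \<open>X 1 ^ (2 * t)\<close> to the next power plus a monomial with a factor \<open>X 3\<close>,
  which reduces to that new \<open>quad_rep\<close>. The start \<open>t = 2\<close> provides the
  \<open>n \<ge> 3\<close> of \<open>Lm2_op_quad_rep\<close>.\<close>

lemma LJ_mod_C2_even:
  assumes "k > 0" "t \<ge> 2"
  shows "X 1 ^ (2 * t) \<in> LJ_mod_C2 k \<and> quad_rep (2 * t) \<in> LJ_mod_C2 k"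
  using assms(2)
proof (induction t rule: nat_induct_at_least)
  case base
  show ?case using LJ_mod_C2_base[OF assms(1)] by simp
next
  case (Suc t)
  define n where "n = 2 * t - 1"
  have n: "n \<ge> 3" "odd n" "2 * t = n + 1" using Suc.hyps by (auto simp: n_def)
  have "X 1 * X n \<in> LJ_mod_C2 k" using Suc.IH n by (simp add: quad_rep_def)
  from LJ_mod_C2_diff[OF LJ_mod_C2_of_nat_mult[OF LJ_mod_C2_Lop[OF assms(1) this], of 4] LJ_mod_C2_K[OF Lm2_op_quad_rep[OF assms(1) n(1,2)]]]
  have "of_nat ((n + 2) * (n + 3)) * (X 1 * X (n + 2)) \<in> LJ_mod_C2 k" by simp
  then have "X 1 * X (n + 2) \<in> LJ_mod_C2 k" by (rule LJ_mod_C2_cancel_of_nat) simp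
  then have y: "quad_rep (2 * Suc t) \<in> LJ_mod_C2 k" using n by (simp add: quad_rep_def)
  let ?P = "add_mset 3 (replicate_mset n 1)"
  have "mon ?P \<in> quad_rep_mod_C2 k (\<Sum>\<^sub># ?P)"
    using n by (intro quad_rep_mod_C2_monomial) auto
  moreover have "\<Sum>\<^sub># ?P = 2 * Suc t" using n by simp
  ultimately have "mon ?P \<in> quad_rep_mod_C2 k (2 * Suc t)" by (simp only:)
  then have "mon ?P \<in> LJ_mod_C2 k" by (rule LJ_mod_C2_Z[OF y])
  then have P: "X 3 * X 1 ^ n \<in> LJ_mod_C2 k" by (simp only: mon_add_mset X1_power)
  have "of_nat (4 * k) * Lm2_op k (X 1 ^ (2 * t)) \<in> LJ_mod_C2 k"
    using Suc.IH by (intro LJ_mod_C2_of_nat_mult LJ_mod_C2_Lop assms) simp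
  from LJ_mod_C2_diff[OF this LJ_mod_C2_of_nat_mult[OF P, of "4 * k * (2 * t)"]]
  have "X 1 ^ (2 * t + 2) \<in> LJ_mod_C2 k"
    unfolding Lm2_op_X1_power[OF assms(1)] n_def[symmetric] by simp
  then show ?case using y by simp
qed

lemma LJ_mod_C2_parity:
  assumes "k > 0" "p \<in> parity False"
  shows "p \<in> LJ_mod_C2 k"
proof (induction p rule: heis_poly_induct)
  case zero
  show ?case by (simp add: LJ_mod_C2_K C2quad.zero)
next
  case (mon P)
  have P: "0 \<notin># P" "even (size P)" using mon assms(2) by (auto simp: parity_def)
  have LJ_mod_C2_Y: "quad_rep w \<in> LJ_mod_C2 k" if "w \<ge> 2" for w
  proof (cases "even w")
    case True
    then obtain t where t: "w = 2 * t" by blast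
    show ?thesis
    proof (cases "t \<ge> 2")
      case False
      then have "w = 2" using t that by simp
      then show ?thesis using LJ_mod_C2_X1_squared[OF assms(1)] by (simp add: quad_rep_def power2_eq_square)
    qed (use LJ_mod_C2_even[OF assms(1)] t in auto)
  next
    case False
    then show ?thesis using quad_rep_odd that by (intro LJ_mod_C2_K) simp
  qed
  show ?case
  proof (cases "\<exists>c\<in>#P. c \<ge> 2")
    case True
    then obtain c where c: "c \<in># P" "c \<ge> 2" by blast
    then have "\<Sum>\<^sub># P \<ge> 2" by (auto dest!: multi_member_split)
    moreover have "mon P \<in> quad_rep_mod_C2 k (\<Sum>\<^sub># P)" using P c by (intro quad_rep_mod_C2_monomial) auto
    ultimately show ?thesis using LJ_mod_C2_Z LJ_mod_C2_Y by blast
  next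
    case False
    then have "\<forall>c\<in>#P. c = 1" using P(1) by (metis Suc_1 Suc_leI le_neq_implies_less less_one not_le One_nat_def)
    then have "P = replicate_mset (size P) 1"
      by (metis set_mset_subset_singletonD singletonI subsetI)
    moreover obtain t where "size P = 2 * t" using P(2) by blast
    ultimately have P: "mon P = X 1 ^ (2 * t)" using X1_power by metis
    consider "t = 0" | "t = 1" | "t \<ge> 2" by linarith
    then show ?thesis
      using LJ_mod_C2_one LJ_mod_C2_X1_squared[OF assms(1)] LJ_mod_C2_even[OF assms(1)] by cases (auto simp: P)
  qed
qed (auto intro: LJ_mod_C2_add LJ_mod_C2_const_mult)

subsection \<open>The Heisenberg part of the lattice model\<close>

definition iota :: "heis_poly \<Rightarrow> vec" where
  "iota p = (\<lambda>(m, P). if m = 0 then Poly_Mapping.lookup p P else 0)"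

lemma iota_0 [simp]: "iota 0 = (\<lambda>y. 0)"
  by (auto simp: iota_def)

lemma iota_add: "iota (p + q) = (\<lambda>y. iota p y + iota q y)"
  by (auto simp: iota_def lookup_add)

lemma iota_const_mult: "iota (const c * p) = (\<lambda>y. c * iota p y)"
  by (auto simp: iota_def lookup_const_mult)

lemma iota_sum: "iota (\<Sum>i\<in>I. f i) = (\<lambda>y. \<Sum>i\<in>I. iota (f i) y)"
  by (induction I rule: infinite_finite_induct) (simp_all add: iota_add)

lemma iota_mon: "iota (mon P) = bas (0, P)"
  by (auto simp: iota_def bas_def mon_def lookup_single when_def)

lemma supp_iota: "supp (iota p) = Pair 0 ` Poly_Mapping.keys p"
  by (auto simp: supp_def iota_def in_keys_iff split: if_splits)

text \<open>Operators of the lattice model are of the form \<open>lin f\<close>, so comparing one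
  with its polynomial counterpart reduces to basis vectors.\<close>

lemma lin_iota:
  assumes "\<And>P. P \<in> Poly_Mapping.keys p \<Longrightarrow> f (0, P) = iota (F P)"
  shows "lin f (iota p) = iota (ext F p)"
proof
  fix y
  have "lin f (iota p) y = (\<Sum>P\<in>Poly_Mapping.keys p. iota p (0, P) * f (0, P) y)"
    unfolding lin_def supp_iota by (subst sum.reindex) (auto simp: inj_on_def)
  also have "\<dots> = (\<Sum>P\<in>Poly_Mapping.keys p. Poly_Mapping.lookup p P * iota (F P) y)"
    by (rule sum.cong) (simp_all add: assms, simp add: iota_def)
  also have "\<dots> = iota (ext F p) y"
    by (simp add: ext_def iota_sum iota_const_mult)
  finally show "lin f (iota p) y = iota (ext F p) y" .
qed

text \<open>For \<open>j = 0\<close> the derivation has value \<open>const 0\<close> everywhere, as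
  \<open>\<alpha>(0)\<close> acts by zero on \<open>M(1)\<close>.\<close>

definition alpha_op :: "nat \<Rightarrow> int \<Rightarrow> heis_poly \<Rightarrow> heis_poly" where
  "alpha_op k j p = (if j < 0 then X (nat (- j)) * p
     else der (\<lambda>q. if q = nat j then const (of_nat (2 * k * nat j)) else 0) p)"

lemma alpha_op_add: "alpha_op k j (p + q) = alpha_op k j p + alpha_op k j q"
  by (simp add: alpha_op_def der_add distrib_left)

lemma alpha_op_zero [simp]: "alpha_op k j 0 = 0"
  by (simp add: alpha_op_def)

lemma alpha_op_const_mult: "alpha_op k j (const c * p) = const c * alpha_op k j p"
  by (simp add: alpha_op_def der_const_mult mult.left_commute)

lemma alpha_op_1: "j \<ge> 0 \<Longrightarrow> alpha_op k j 1 = 0"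
  by (simp add: alpha_op_def)

lemma parity_alpha_op:
  assumes "p \<in> parity b"
  shows "alpha_op k j p \<in> parity (\<not> b)"
proof -
  have "X (nat (- j)) * p \<in> parity (\<not> b)" if "j < 0"
    using parity_mult[of "X (nat (- j))" True p b] assms that by simp
  moreover have "(if q = nat j then const c else 0) \<in> parity False" for q c
    using parity_const_mult[of 1 False c] by simp
  ultimately show ?thesis
    using parity_der[OF assms, of "\<lambda>q. if q = nat j then const (of_nat (2 * k * nat j)) else 0" False]
    by (simp add: alpha_op_def)
qed

lemma heis_iota: "heis k j (iota p) = iota (alpha_op k j p)"
proof -
  define F where "F P = alpha_op k j (mon P)" for P
  have count: "(\<Sum>q\<in>#M. if q = n then A else 0) = of_nat (count M n) * A" for M n and A :: heis_poly
    by (induction M) (simp_all add: algebra_simps)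
  have "heisb k j (0, P) = iota (F P)" for P
  proof (cases "j < 0")
    case True
    then show ?thesis
      by (simp add: F_def alpha_op_def heisb_def iota_mon flip: mon_add_mset)
  next
    case False
    define n where "n = nat j"
    have "F P = (\<Sum>q\<in>#P. if q = n then const (of_nat (2 * k * n)) * mon (P - {#n#}) else 0)"
      using False unfolding F_def alpha_op_def der_mon dmon_def n_def
      by (auto intro!: arg_cong[of _ _ sum_mset] image_mset_cong)
    also have "\<dots> = of_nat (count P n) * (const (of_nat (2 * k * n)) * mon (P - {#n#}))"
      by (rule count)
    also have "\<dots> = const (of_nat (count P n) * of_nat (2 * k * n)) * mon (P - {#n#})"
      by (simp only: const_mult single_of_nat mult.assoc)
    finally show ?thesis
      using False by (auto simp: heisb_def n_def iota_const_mult iota_mon)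
  qed
  then have "heis k j (iota p) = iota (ext F p)"
    unfolding heis_def by (rule lin_iota)
  also have "ext F p = alpha_op k j p"
    by (induction p rule: heis_poly_induct)
      (simp_all add: ext_add ext_const_mult alpha_op_add alpha_op_const_mult, simp add: F_def)
  finally show ?thesis .
qed

text \<open>The recursion of \<open>modeL\<close> for \<open>m0 = 0\<close>, with the same
  truncation bound, so that the two agree term by term on the sector \<open>m = 0\<close>.\<close>

primrec hmode :: "nat \<Rightarrow> nat list \<Rightarrow> int \<Rightarrow> heis_poly \<Rightarrow> heis_poly" where
  "hmode k [] j p = (if j = -1 then p else 0)"
| "hmode k (n # ns) j p = ext (\<lambda>P. \<Sum>i\<in>{0..nat \<bar>j\<bar> + sum_list ns + \<Sum>\<^sub># P}.
     const (of_nat ((n + i - 1) choose i))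
     * (alpha_op k (- int n - int i) (hmode k ns (j + int i) (mon P))
        + const ((-1) ^ (n + 1)) * hmode k ns (j - int n - int i) (alpha_op k (int i) (mon P)))) p"

lemma hmode_add: "hmode k ns j (p + q) = hmode k ns j p + hmode k ns j q"
  by (cases ns) (simp_all add: ext_add)

lemma hmode_0 [simp]: "hmode k ns j 0 = 0"
  by (cases ns) simp_all

lemma hmode_const_mult: "hmode k ns j (const c * p) = const c * hmode k ns j p"
  by (cases ns) (simp_all add: ext_const_mult)

lemma finite_submultisets: "finite {Q. Q \<subseteq># P}"
proof (induction P)
  case (add x P)
  have "{Q. Q \<subseteq># add_mset x P} \<subseteq> {Q. Q \<subseteq># P} \<union> add_mset x ` {Q. Q \<subseteq># P}"
  proof
    fix Q assume Q: "Q \<in> {Q. Q \<subseteq># add_mset x P}"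
    show "Q \<in> {Q. Q \<subseteq># P} \<union> add_mset x ` {Q. Q \<subseteq># P}"
    proof (cases "x \<in># Q")
      case True
      then obtain Q' where "Q = add_mset x Q'" by (blast dest: multi_member_split)
      then show ?thesis using Q by auto
    next
      case False
      then have "count Q y \<le> count P y" for y
        using Q by (cases "y = x") (auto simp: subseteq_mset_def not_in_iff dest: spec[of _ y])
      then show ?thesis by (simp add: subseteq_mset_def)
    qed
  qed
  then show ?case using add.IH finite_subset by blast
qed simp

text \<open>For \<open>m0 = 0\<close> the factors \<open>0 ^ size Q\<close> and
  \<open>0 ^ size R\<close> leave only \<open>Q = R = {#}\<close>, and the weight condition then
  forces \<open>j = -1\<close>.\<close>

lemma ebb_0: "ebb k 0 j (0, P) = (if j = - 1 then bas (0, P) else (\<lambda>y. 0))"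
proof
  fix y
  let ?R = "\<lambda>Q. {R. 0 \<notin># R \<and> int (sum_mset R) = int (sum_mset Q) - 2 * int k * 0 * 0 - j - 1}"
  let ?t = "\<lambda>Q R. ((\<Prod>n\<in>set_mset P. of_nat (count P n choose count Q n))
          * (- (of_nat (2 * k) * of_int 0)) ^ size Q * (of_int 0) ^ size R
          / (\<Prod>n\<in>set_mset R. of_nat (n ^ count R n * fact (count R n))))
         * bas (0 + 0, P - Q + R) y :: complex"
  have "ebb k 0 j (0, P) y = (\<Sum>Q\<in>{Q. Q \<subseteq># P}. \<Sum>R\<in>?R Q. ?t Q R)"
    by (simp add: ebb_def)
  also have "\<dots> = (\<Sum>Q\<in>{Q. Q \<subseteq># P}. if Q = {#} then (\<Sum>R\<in>?R {#}. ?t {#} R) else 0)"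
    by (intro sum.cong refl) (auto simp: power_0_left)
  also have "\<dots> = (\<Sum>R\<in>?R {#}. ?t {#} R)"
    by (subst sum.delta) (auto intro: finite_submultisets)
  also have "\<dots> = (if j = - 1 then bas (0, P) else (\<lambda>y. 0)) y"
  proof (cases "j = - 1")
    case True
    have "R = {#}" if "0 \<notin># R" "sum_mset R = 0" for R :: "nat multiset"
      using that by (metis multiset_nonemptyE sum_mset_0_iff)
    then have "?R {#} = {{#}}" using True by (auto simp del: of_nat_sum_mset)
    then show ?thesis using True by simp
  next
    case False
    have "(\<Sum>R\<in>?R {#}. ?t {#} R) = 0"
    proof (rule sum.neutral, rule ballI)
      fix R assume "R \<in> ?R {#}"
      then have "R \<noteq> {#}" using False by auto
      then show "?t {#} R = 0" by (simp add: power_0_left)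
    qed
    then show ?thesis using False by (simp only: if_False)
  qed
  finally show "ebb k 0 j (0, P) y = (if j = - 1 then bas (0, P) else (\<lambda>y. 0)) y" .
qed

lemma ext_mon_id: "ext mon p = p"
  unfolding ext_def by (rule poly_expand[symmetric])

lemma modeL_iota: "modeL k 0 ns j (iota p) = iota (hmode k ns j p)"
proof (induction ns arbitrary: j p)
  case Nil
  define F where "F P = (if j = - 1 then mon P else 0)" for P
  have "ext F p = hmode k [] j p"
    by (cases "j = - 1") (simp_all add: F_def[abs_def] ext_mon_id, simp add: ext_def)
  then show ?case
    using lin_iota[of p "ebb k 0 j" F] by (simp add: ebb_0 F_def iota_mon del: hmode.simps)
next
  case (Cons n ns)
  show ?case
    unfolding modeL.simps hmode.simps
  proof (rule lin_iota, rule ext)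
    fix P y
    have "wt k (0, mset ns) = sum_list ns" "wt k (0, P) = \<Sum>\<^sub># P"
      by (simp_all add: wt_def sum_mset_sum_list)
    then show "(\<Sum>i\<in>{0..nat \<bar>j\<bar> + wt k (0, mset ns) + wt k (0, P)}.
       of_nat ((n + i - 1) choose i)
       * (heis k (- int n - int i) (modeL k 0 ns (j + int i) (bas (0, P))) y
          + (-1) ^ (n + 1) * modeL k 0 ns (j - int n - int i) (heis k (int i) (bas (0, P))) y))
      = iota (\<Sum>i\<in>{0..nat \<bar>j\<bar> + sum_list ns + \<Sum>\<^sub># P}.
     const (of_nat ((n + i - 1) choose i))
     * (alpha_op k (- int n - int i) (hmode k ns (j + int i) (mon P))
        + const ((-1) ^ (n + 1)) * hmode k ns (j - int n - int i) (alpha_op k (int i) (mon P)))) y"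
      unfolding iota_sum iota_const_mult iota_add
      by (simp only: iota_mon[symmetric] heis_iota Cons.IH)
  qed
qed

lemma mode_iota:
  "mode k (iota w) j (iota p) = iota (ext (\<lambda>P. hmode k (sorted_list_of_multiset P) j p) w)"
proof -
  have "mode k (iota w) j (iota p)
      = lin (\<lambda>b. modeL k (fst b) (sorted_list_of_multiset (snd b)) j (iota p)) (iota w)"
    by (simp add: mode_def lin_def)
  also have "\<dots> = iota (ext (\<lambda>P. hmode k (sorted_list_of_multiset P) j p) w)"
    by (rule lin_iota) (simp add: modeL_iota)
  finally show ?thesis .
qed

text \<open>Each Heisenberg mode flips the parity of the degree. This shows that
  \<open>J_{-1}\<close> preserves \<open>M(1)^+\<close> without a formula for its quartic
  part.\<close>

lemma parity_hmode:
  assumes "p \<in> parity b" "0 \<notin> set ns"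
  shows "hmode k ns j p \<in> parity (b \<noteq> odd (length ns))"
  using assms
proof (induction ns arbitrary: j p b)
  case (Cons n ns)
  have IH: "hmode k ns j p \<in> parity (c \<noteq> odd (length ns))" if "p \<in> parity c" for j p c
    using Cons.IH[OF that] Cons.prems by simp
  show ?case
    unfolding hmode.simps
  proof (rule parity_ext[OF Cons.prems(1)])
    fix P :: "nat multiset" assume P: "odd (size P) = b" "0 \<notin># P"
    then have m: "mon P \<in> parity b" by simp
    show "(\<Sum>i\<in>{0..nat \<bar>j\<bar> + sum_list ns + \<Sum>\<^sub># P}.
       const (of_nat ((n + i - 1) choose i))
       * (alpha_op k (- int n - int i) (hmode k ns (j + int i) (mon P))
        + const ((-1) ^ (n + 1)) * hmode k ns (j - int n - int i) (alpha_op k (int i) (mon P))))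
      \<in> parity (b \<noteq> odd (length (n # ns)))"
    proof (intro parity_sum parity_const_mult parity_add)
      fix i
      show "alpha_op k (- int n - int i) (hmode k ns (j + int i) (mon P)) \<in> parity (b \<noteq> odd (length (n # ns)))"
        using parity_alpha_op[OF IH[OF m]] by (auto split: if_splits)
      show "hmode k ns (j - int n - int i) (alpha_op k (int i) (mon P)) \<in> parity (b \<noteq> odd (length (n # ns)))"
        using IH[OF parity_alpha_op[OF m]] by (auto split: if_splits)
    qed
  qed
qed auto

text \<open>The creation property. Its halves are proved together: in the (-1)-mode the terms with
  \<open>i > 0\<close> contain nonnegative modes applied to the vacuum.\<close>

lemma hmode_vacuum:
  assumes "0 \<notin> set ns"
  shows "hmode k ns (-1) 1 = mon (mset ns)" and "j \<ge> 0 \<Longrightarrow> hmode k ns j 1 = 0"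
  using assms
proof (induction ns arbitrary: j)
  case (Cons n ns)
  have ext1: "ext F 1 = F {#}" for F using ext_mon[of F "{#}"] by simp
  {
    case 1
    have *: "const (of_nat ((n + i - 1) choose i))
     * (alpha_op k (- int n - int i) (hmode k ns (-1 + int i) (mon {#}))
        + const ((-1) ^ (n + 1)) * hmode k ns (-1 - int n - int i) (alpha_op k (int i) (mon {#})))
      = (if i = 0 then mon (mset (n # ns)) else 0)" for i
      using 1 Cons.IH(1) Cons.IH(2)[of "-1 + int i"] by (simp add: alpha_op_1, simp add: alpha_op_def mon_add_mset)
    show ?case unfolding hmode.simps ext1 * by simp
  next
    case 2
    have *: "const (of_nat ((n + i - 1) choose i))
     * (alpha_op k (- int n - int i) (hmode k ns (j + int i) (mon {#}))
        + const ((-1) ^ (n + 1)) * hmode k ns (j - int n - int i) (alpha_op k (int i) (mon {#}))) = 0" for i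
      using 2 Cons.IH(2)[of "j + int i"] by (simp add: alpha_op_1)
    show ?case unfolding hmode.simps ext1 * by simp
  }
qed auto

text \<open>\<open>\<alpha>(-b) 1\<close> is the divided derivative of order \<open>b - 1\<close> of
  \<open>\<alpha>(-1) 1\<close>, so its field is that derivative of the Heisenberg field; the
  binomial comes from differentiating powers of the formal variable.\<close>

lemma hmode_single:
  assumes "b \<ge> 1"
  shows "hmode k [b] j p = const (of_int (int b - 2 - j) gchoose (b - 1)) * alpha_op k (j - int b + 1) p"
proof (induction p rule: heis_poly_induct)
  case (mon P)
  define c :: complex where "c = of_int (int b - 2 - j) gchoose (b - 1)"
  define I where "I = {0..nat \<bar>j\<bar> + \<Sum>\<^sub># P}"
  have L: "hmode k [b] j (mon P) = (\<Sum>i\<in>I. const (of_nat ((b + i - 1) choose i))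
     * (alpha_op k (- int b - int i) (if j + int i = - 1 then mon P else 0)
        + const ((-1) ^ (b + 1)) * (if j - int b - int i = - 1 then alpha_op k (int i) (mon P) else 0)))"
    by (simp add: I_def)
  \<comment> \<open>For \<open>j < 0\<close> only the creation term \<open>i = -1 - j\<close>
    survives, for \<open>j \<ge> b - 1\<close> only the term \<open>i = j - b + 1\<close> of the
    other kind; in between there is none and the binomial vanishes.\<close>
  consider "j < 0" | "0 \<le> j" "j < int b - 1" | "int b - 1 \<le> j" "0 \<le> j" by linarith
  then show ?case
  proof cases
    case 1
    define n where "n = nat (- 1 - j)"
    have "n \<in> I" using 1 by (auto simp: I_def n_def)
    have "hmode k [b] j (mon P) = (\<Sum>i\<in>I. if i = n then
        const (of_nat ((b + n - 1) choose n)) * alpha_op k (- int b - int n) (mon P) else 0)"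
      unfolding L using 1 assms by (intro sum.cong refl) (auto simp: n_def)
    also have "\<dots> = const (of_nat ((b + n - 1) choose n)) * alpha_op k (- int b - int n) (mon P)"
      using \<open>n \<in> I\<close> by (simp add: I_def)
    also have "- int b - int n = j - int b + 1" using 1 by (simp add: n_def)
    also have "of_nat ((b + n - 1) choose n) = c"
    proof -
      have "of_int (int b - 2 - j) = (of_nat (b + n - 1) :: complex)"
        using 1 assms by (simp add: n_def of_nat_diff)
      moreover have "(b + n - 1) choose n = (b + n - 1) choose (b - 1)"
        using binomial_symmetric[of n "b + n - 1"] assms by simp
      ultimately show ?thesis by (simp add: c_def binomial_gbinomial)
    qed
    finally show ?thesis by (simp add: c_def)
  next
    case 2
    have "hmode k [b] j (mon P) = 0" unfolding L using 2 by (intro sum.neutral) auto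
    moreover have "c = 0"
    proof -
      have "c = of_nat (nat (int b - 2 - j) choose (b - 1))"
        unfolding binomial_gbinomial c_def using 2 by simp
      then show ?thesis using 2 by (simp add: binomial_eq_0)
    qed
    ultimately show ?thesis by (simp add: c_def)
  next
    case 3
    define n where "n = nat (j - int b + 1)"
    have "n \<in> I" using 3 assms by (auto simp: I_def n_def)
    have "hmode k [b] j (mon P) = (\<Sum>i\<in>I. if i = n then
        const (of_nat ((b + n - 1) choose n)) * (const ((-1) ^ (b + 1)) * alpha_op k (int n) (mon P)) else 0)"
      unfolding L using 3 assms by (intro sum.cong refl) (auto simp: n_def)
    also have "\<dots> = const (of_nat ((b + n - 1) choose n)) * (const ((-1) ^ (b + 1)) * alpha_op k (int n) (mon P))"
      using \<open>n \<in> I\<close> by (simp add: I_def)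
    also have "\<dots> = const (of_nat ((b + n - 1) choose n) * (-1) ^ (b + 1)) * alpha_op k (j - int b + 1) (mon P)"
      unfolding const_mult mult.assoc using 3 by (simp only: n_def) simp
    also have "of_nat ((b + n - 1) choose n) * (-1) ^ (b + 1) = c"
    proof -
      have "of_int (int b - 2 - j) = - (of_nat (n + 1) :: complex)"
        using 3 assms by (simp add: n_def)
      then have "c = (-1) ^ (b - 1) * (of_nat (n + 1) + of_nat (b - 1) - 1 gchoose (b - 1))"
        unfolding c_def by (simp only: gbinomial_minus)
      also have "of_nat (n + 1) + of_nat (b - 1) - 1 = (of_nat (b + n - 1) :: complex)"
        using assms by (simp add: of_nat_diff)
      also have "((-1) :: complex) ^ (b - 1) = (-1) ^ (b + 1)"
        using assms by (cases b) auto
      also have "(of_nat (b + n - 1) gchoose (b - 1)) = (of_nat ((b + n - 1) choose n) :: complex)"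
      proof -
        have "(b + n - 1) choose n = (b + n - 1) choose (b - 1)"
          using binomial_symmetric[of n "b + n - 1"] assms by simp
        then show ?thesis by (simp only: binomial_gbinomial)
      qed
      finally show ?thesis by simp
    qed
    finally show ?thesis by (simp add: c_def)
  qed
next
  case (add p q)
  then show ?case unfolding hmode_add alpha_op_add distrib_left by simp
next
  case (scale c p)
  then show ?case unfolding hmode_const_mult alpha_op_const_mult by (simp only: mult.left_commute)
qed (simp del: hmode.simps)

lemma member_le_sum_mset: "q \<in># P \<Longrightarrow> q \<le> \<Sum>\<^sub># P" for q :: nat
  by (auto dest!: multi_member_split)

text \<open>A mode \<open>\<alpha>(q)\<close> with \<open>q\<close> above the weight kills the
  monomial, so the truncated sum is already the full derivation.\<close>

lemma sum_X_H:
  assumes "\<Sum>\<^sub># P \<le> B"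
  shows "(\<Sum>q\<in>{0..B}. const (f q) * (X (N + q) * alpha_op k (int q) (mon P)))
    = der (\<lambda>q. const (of_nat (2 * k * q) * f q) * X (N + q)) (mon P)"
proof -
  define d where "d q r = const (f q) * (X (N + q) * (if r = q then const (of_nat (2 * k * q)) else 0))"
    for q r
  have "(\<Sum>q\<in>{0..B}. const (f q) * (X (N + q) * alpha_op k (int q) (mon P)))
      = der (\<lambda>r. \<Sum>q\<in>{0..B}. d q r) (mon P)"
    unfolding der_fun_sum d_def der_fun_mult alpha_op_def nat_int by simp
  also have "\<dots> = der (\<lambda>q. const (of_nat (2 * k * q) * f q) * X (N + q)) (mon P)"
  proof (rule der_mon_cong)
    fix r assume "r \<in># P"
    then have r: "r \<in> {0..B}" using assms member_le_sum_mset[of r P] by simp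
    have "(\<Sum>q\<in>{0..B}. d q r)
        = (\<Sum>q\<in>{0..B}. if q = r then const (f r) * (X (N + r) * const (of_nat (2 * k * r))) else 0)"
      by (rule sum.cong) (auto simp: d_def)
    also have "\<dots> = const (of_nat (2 * k * r) * f r) * X (N + r)"
      using r by (simp add: const_mult ac_simps del: single_of_nat)
    finally show "(\<Sum>q\<in>{0..B}. d q r) = const (of_nat (2 * k * r) * f r) * X (N + r)" .
  qed
  finally show ?thesis .
qed

lemma of_nat_choose_gchoose:
  assumes "a \<ge> 1"
  shows "of_nat ((a + i - 1) choose i) = (of_nat (a + i - 1) gchoose (a - 1) :: complex)"
proof -
  have "(a + i - 1) choose i = (a + i - 1) choose (a - 1)"
    using binomial_symmetric[of i "a + i - 1"] assms by simp
  then show ?thesis by (simp only: binomial_gbinomial)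
qed

text \<open>In the iterate formula the second sum carries the values \<open>g(-i)\<close>. The first
  runs over \<open>c = a + i\<close>: for \<open>c < N\<close> both factors are creation operators
  and form \<open>quad\<close>, while \<open>c = N + q\<close> pairs \<open>X (N + q)\<close> with
  \<open>\<alpha>(q)\<close> and carries \<open>g(N + q)\<close>.\<close>

lemma hmode_pair:
  assumes "a \<ge> 1" "b \<ge> 1" "j < 0" "int N = int a + int b - 1 - j"
  shows "hmode k [a, b] j p = qop k N (bfun N a b) p"
proof (induction p rule: heis_poly_induct)
  case (mon P)
  define g where "g = bfun N a b"
  define T where "T c = const (g (of_nat c)) * (X c * alpha_op k (int c - int N) (mon P))" for c
  define M where "M = nat \<bar>j\<bar> + sum_list [b] + \<Sum>\<^sub># P"
  have M: "a + M = N + (1 + \<Sum>\<^sub># P)" using assms by (simp add: M_def)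
  have g_pos: "g (of_nat (a + i)) = of_nat ((a + i - 1) choose i) * (of_int (int b - 2 - (j + int i)) gchoose (b - 1))" for i
  proof -
    have "of_nat (a + i) - 1 = (of_nat (a + i - 1) :: complex)" using assms by (simp add: of_nat_diff)
    moreover have "of_nat N - 1 - of_nat (a + i) = (of_int (int N - 1 - int (a + i)) :: complex)" by simp
    moreover have "int N - 1 - int (a + i) = int b - 2 - (j + int i)" using assms by simp
    ultimately show ?thesis
      unfolding g_def bfun_def by (simp only: of_nat_choose_gchoose[OF assms(1)])
  qed
  have g_neg: "g (- of_nat i) = of_nat ((a + i - 1) choose i) * (-1) ^ (a + 1)
      * (of_int (int b - 2 - (j - int a - int i)) gchoose (b - 1))" for i
  proof -
    have "- of_nat i - 1 = - (of_nat (i + 1) :: complex)" by simp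
    moreover have "(- of_nat (i + 1) gchoose (a - 1))
        = (-1 :: complex) ^ (a - 1) * (of_nat (i + 1) + of_nat (a - 1) - 1 gchoose (a - 1))"
      by (rule gbinomial_minus)
    moreover have "of_nat (i + 1) + of_nat (a - 1) - 1 = (of_nat (a + i - 1) :: complex)"
      using assms by (simp add: of_nat_diff)
    moreover have "(-1 :: complex) ^ (a - 1) = (-1) ^ (a + 1)" using assms by (cases a) auto
    moreover have "of_nat N - 1 - - of_nat i = (of_int (int N - 1 + int i) :: complex)" by simp
    moreover have "int N - 1 + int i = int b - 2 - (j - int a - int i)" using assms by simp
    ultimately show ?thesis
      unfolding g_def bfun_def by (simp only: of_nat_choose_gchoose[OF assms(1)] mult.commute)
  qed
  have "hmode k [a, b] j (mon P) = (\<Sum>i\<in>{0..M}.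
     const (of_nat ((a + i - 1) choose i))
     * (alpha_op k (- int a - int i) (hmode k [b] (j + int i) (mon P))
        + const ((-1) ^ (a + 1)) * hmode k [b] (j - int a - int i) (alpha_op k (int i) (mon P))))"
    unfolding hmode.simps(2)[of k a] ext_mon M_def ..
  also have "\<dots> = (\<Sum>i\<in>{0..M}. T (a + i) + const (g (- of_nat i)) * (X (N + i) * alpha_op k (int i) (mon P)))"
  proof (rule sum.cong[OF refl])
    fix i
    have neg: "alpha_op k (- int n) q = X n * q" if "n > 0" for n q
      using that by (simp add: alpha_op_def)
    have 1: "alpha_op k (- int a - int i) q = X (a + i) * q" for q
      using neg[of "a + i" q] assms by simp
    have "j - int a - int i - int b + 1 = - int (N + i)" using assms by simp
    then have 2: "alpha_op k (j - int a - int i - int b + 1) q = X (N + i) * q" for q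
      using neg[of "N + i" q] assms by (simp only:)
    have 3: "j + int i - int b + 1 = int (a + i) - int N" using assms by simp
    show "const (of_nat ((a + i - 1) choose i))
     * (alpha_op k (- int a - int i) (hmode k [b] (j + int i) (mon P))
        + const ((-1) ^ (a + 1)) * hmode k [b] (j - int a - int i) (alpha_op k (int i) (mon P)))
      = T (a + i) + const (g (- of_nat i)) * (X (N + i) * alpha_op k (int i) (mon P))"
      unfolding hmode_single[OF assms(2)] 1 2 3 T_def g_pos g_neg const_mult distrib_left
      by (simp only: ac_simps)
  qed
  also have "\<dots> = (\<Sum>i\<in>{0..M}. T (a + i))
      + (\<Sum>i\<in>{0..M}. const (g (- of_nat i)) * (X (N + i) * alpha_op k (int i) (mon P)))"
    by (rule sum.distrib)
  also have "(\<Sum>i\<in>{0..M}. T (a + i)) = (\<Sum>c\<in>{a..a + M}. T c)"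
    using sum.atLeastAtMost_shift_0[of a "a + M" T] by simp
  also have "\<dots> = (\<Sum>c\<in>{1..a + M}. T c)"
  \<comment> \<open>Indices below \<open>a\<close> can be added, as the first binomial of
    \<open>bfun\<close> vanishes there.\<close>
  proof (rule sum.mono_neutral_left)
    show "\<forall>c\<in>{1..a + M} - {a..a + M}. T c = 0"
    proof
      fix c assume "c \<in> {1..a + M} - {a..a + M}"
      then have "1 \<le> c" "c < a" by auto
      then have "(of_nat c - 1 gchoose (a - 1)) = (of_nat (c - 1 choose (a - 1)) :: complex)"
        by (simp add: binomial_gbinomial of_nat_diff)
      also have "\<dots> = 0" using \<open>1 \<le> c\<close> \<open>c < a\<close> by simp
      finally show "T c = 0" by (simp add: T_def g_def bfun_def)
    qed
  qed (use assms in auto)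
  also have "\<dots> = (\<Sum>c\<in>{1..<N}. T c) + (\<Sum>c\<in>{N..a + M}. T c)"
  proof -
    have "{1..a + M} = {1..<N} \<union> {N..a + M}" using assms M by auto
    moreover have "{1..<N} \<inter> {N..a + M} = {}" by auto
    ultimately show ?thesis by (simp only: sum.union_disjoint finite_atLeastLessThan finite_atLeastAtMost)
  qed
  also have "(\<Sum>c\<in>{1..<N}. T c) = quad N g * mon P"
    unfolding quad_def sum_distrib_right
    by (rule sum.cong) (auto simp: T_def alpha_op_def mult.assoc nat_diff_distrib)
  also have "(\<Sum>c\<in>{N..a + M}. T c) = (\<Sum>q\<in>{0..1 + \<Sum>\<^sub># P}. T (N + q))"
    using sum.atLeastAtMost_shift_0[of N "a + M" T] M by simp
  also have "\<dots> = (\<Sum>q\<in>{0..1 + \<Sum>\<^sub># P}. const (g (of_nat (N + q))) * (X (N + q) * alpha_op k (int q) (mon P)))"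
    by (simp add: T_def)
  also have "\<dots> = der (\<lambda>q. const (of_nat (2 * k * q) * g (of_nat (N + q))) * X (N + q)) (mon P)"
    by (rule sum_X_H) simp
  also have "(\<Sum>i\<in>{0..M}. const (g (- of_nat i)) * (X (N + i) * alpha_op k (int i) (mon P)))
      = der (\<lambda>q. const (of_nat (2 * k * q) * g (- of_nat q)) * X (N + q)) (mon P)"
    by (rule sum_X_H) (simp add: M_def)
  also have "quad N g * mon P
      + der (\<lambda>q. const (of_nat (2 * k * q) * g (of_nat (N + q))) * X (N + q)) (mon P)
      + der (\<lambda>q. const (of_nat (2 * k * q) * g (- of_nat q)) * X (N + q)) (mon P)
    = qop k N g (mon P)"
    unfolding qop_def add.assoc der_fun_add[symmetric] distrib_right[symmetric] const_add[symmetric]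
      distrib_left[symmetric]
    by (simp only: qder_def[abs_def] add.commute)
  finally show ?case by (simp only: g_def)
next
  case (add p q)
  then show ?case by (simp only: hmode_add qop_add)
next
  case (scale c p)
  then show ?case by (simp only: hmode_const_mult qop_const_mult)
qed (simp del: hmode.simps)

lemma bfun_reflect: "bfun N a b (of_nat N - z) = bfun N b a z"
  by (simp add: bfun_def algebra_simps)

text \<open>The lattice mode is defined through the sorted list, which may be \<open>[a, b]\<close>
  or \<open>[b, a]\<close>; the reflection symmetry makes both orders give the same
  operator.\<close>

lemma mode_pair_iota:
  assumes "a \<ge> 1" "b \<ge> 1" "j < 0" "int N = int a + int b - 1 - j"
  shows "mode k (iota (mon {#a, b#})) j (iota p) = iota (qop k N (bfun N a b) p)"
proof -
  have "qop k N (bfun N b a) = qop k N (bfun N a b)"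
    using qop_reflect[of k N "bfun N a b"] by (simp add: bfun_reflect)
  then have "hmode k (sorted_list_of_multiset {#a, b#}) j p = qop k N (bfun N a b) p"
    using hmode_pair[OF assms, of k p] hmode_pair[OF assms(2,1,3), of N k p] assms(4)
    by (auto simp del: hmode.simps)
  then show ?thesis unfolding mode_iota ext_mon by simp
qed

section \<open>\<open>L(-2)\<close>, \<open>J_{-1}\<close> and \<open>M(1)^+\<close> in the lattice
  model\<close>

lemma Lm2_iota: "Lm2 k (iota p) = iota (Lm2_op k p)"
proof -
  have "omega k = iota (const (1 / of_nat (4 * k)) * mon {#1, 1#})"
    by (simp only: omega_def iota_const_mult iota_mon)
  moreover have "hmode k [1, 1] (-1) p = qop k 2 (bfun 2 1 1) p"
    by (rule hmode_pair) auto
  moreover have "bfun 2 1 1 = (\<lambda>_. 1)" by (simp add: bfun_def fun_eq_iff)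
  ultimately show ?thesis
    unfolding Lm2_def Lm2_op_def by (simp add: mode_iota ext_const_mult del: hmode.simps)
qed

lemma Jpoly_eq_sum: "Jpoly k = const (1 / of_nat (4 * k ^ 2)) * mon {#1, 1, 1, 1#}
    + const (- 1 / of_nat k) * mon {#3, 1#} + const (3 / of_nat (4 * k)) * mon {#2, 2#}"
  by (simp add: Jpoly_def single_uminus)

lemma Jv_iota: "Jv k = iota (Jpoly k)"
  by (simp add: Jpoly_eq_sum Jv_def iota_add iota_const_mult iota_mon)

lemma parity_Jpoly: "Jpoly k \<in> parity False"
  unfolding Jpoly_eq_sum by (intro parity_add parity_const_mult) auto

lemma Jm1_iota:
  assumes "p \<in> parity False"
  obtains q where "q \<in> parity False" "Jm1 k (iota p) = iota q"
proof
  show "Jm1 k (iota p) = iota (ext (\<lambda>P. hmode k (sorted_list_of_multiset P) (-1) p) (Jpoly k))"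
    by (simp only: Jm1_def Jv_iota mode_iota)
  show "ext (\<lambda>P. hmode k (sorted_list_of_multiset P) (-1) p) (Jpoly k) \<in> parity False"
  proof (rule parity_ext[OF parity_Jpoly])
    fix P :: "nat multiset" assume P: "odd (size P) = False" "0 \<notin># P"
    have "length (sorted_list_of_multiset P) = size P"
      by (metis mset_sorted_list_of_multiset size_mset)
    then show "hmode k (sorted_list_of_multiset P) (-1) p \<in> parity False"
      using parity_hmode[OF assms, of "sorted_list_of_multiset P" k "-1"] P by simp
  qed
qed

lemma vac_iota: "vac = iota 1"
  using iota_mon[of "{#}"] by (simp add: vac_def)

lemma Jm1_vac: "Jm1 k vac = iota (Jpoly k)"
proof -
  have "hmode k (sorted_list_of_multiset P) (-1) 1 = mon P" if "P \<in> Poly_Mapping.keys (Jpoly k)" for P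
    using hmode_vacuum(1)[of "sorted_list_of_multiset P" k] that parity_Jpoly[of k]
    by (auto simp: parity_def)
  then have "ext (\<lambda>P. hmode k (sorted_list_of_multiset P) (-1) 1) (Jpoly k) = ext mon (Jpoly k)"
    by (simp add: ext_def)
  then show ?thesis unfolding Jm1_def Jv_iota vac_iota mode_iota ext_mon_id by simp
qed

lemma Lm2_funpow_iota: "(Lm2 k ^^ s) (iota p) = iota ((Lm2_op k ^^ s) p)"
  by (induction s) (simp_all add: Lm2_iota)

lemma M1plus_eq: "M1plus = iota ` parity False"
proof (intro equalityI subsetI)
  fix u assume u: "u \<in> M1plus"
  then have fin: "finite (supp u)" and zero: "\<And>m P. u (m, P) \<noteq> 0 \<Longrightarrow> 0 \<notin># P"
    and m0: "\<And>m P. u (m, P) \<noteq> 0 \<Longrightarrow> m = 0" and th: "theta u = u"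
    by (auto simp: M1plus_def M1_def VL_def)
  have "{P. u (0, P) \<noteq> 0} \<subseteq> snd ` supp u" by (force simp: supp_def)
  then have fin': "finite {P. u (0, P) \<noteq> 0}" using fin finite_surj by blast
  define p where "p = Abs_poly_mapping (\<lambda>P. u (0, P))"
  have lp: "Poly_Mapping.lookup p = (\<lambda>P. u (0, P))" using fin' by (simp add: p_def)
  have "u = iota p"
    using m0 by (auto simp: iota_def lp fun_eq_iff)
  moreover have "p \<in> parity False"
  proof -
    have "even (size P)" if "u (0, P) \<noteq> 0" for P
    proof (rule ccontr)
      assume "odd (size P)"
      then have "theta u (0, P) = - u (0, P)" by (simp add: theta_def)
      then show False using th that by simp
    qed
    then show ?thesis using zero by (auto simp: parity_def in_keys_iff lp)
  qed
  ultimately show "u \<in> iota ` parity False" by blast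
next
  fix u assume "u \<in> iota ` parity False"
  then obtain p where p: "p \<in> parity False" and u: "u = iota p" by blast
  have "(-1) ^ size P * Poly_Mapping.lookup p P = Poly_Mapping.lookup p P" for P
    using p by (cases "Poly_Mapping.lookup p P = 0") (auto simp: parity_def in_keys_iff)
  then have "theta u = u" by (auto simp: u theta_def iota_def fun_eq_iff)
  moreover have "finite (supp u)" by (simp add: u supp_iota)
  ultimately show "u \<in> M1plus"
    using p by (auto simp: M1plus_def M1_def VL_def u iota_def parity_def in_keys_iff split: if_splits)
qed

lemma M1plus_subset_VLplus: "M1plus \<subseteq> VLplus"
  by (auto simp: M1plus_def VLplus_def M1_def)

subsection \<open>Spans\<close>

lemma cspan_zero: "(\<lambda>y. 0) \<in> cspan S"
  unfolding cspan_def by (intro CollectI exI[of _ "{}"]) simp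

lemma cspan_base: "v \<in> S \<Longrightarrow> v \<in> cspan S"
  unfolding cspan_def by (intro CollectI exI[of _ "{v}"] exI[of _ "\<lambda>_. 1"]) simp

lemma cspan_scale:
  assumes "u \<in> cspan S"
  shows "(\<lambda>y. c * u y) \<in> cspan S"
proof -
  obtain F d where "finite F" "F \<subseteq> S" "u = (\<lambda>y. \<Sum>v\<in>F. d v * v y)"
    using assms by (auto simp: cspan_def)
  then show ?thesis unfolding cspan_def
    by (intro CollectI exI[of _ F] exI[of _ "\<lambda>v. c * d v"]) (simp add: sum_distrib_left mult.assoc)
qed

lemma cspan_add:
  assumes "u \<in> cspan S" "w \<in> cspan S"
  shows "(\<lambda>y. u y + w y) \<in> cspan S"
proof -
  obtain F c G d where F: "finite F" "F \<subseteq> S" "u = (\<lambda>y. \<Sum>v\<in>F. c v * v y)"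
    and G: "finite G" "G \<subseteq> S" "w = (\<lambda>y. \<Sum>v\<in>G. d v * v y)"
    using assms by (auto simp: cspan_def)
  have "(\<lambda>y. u y + w y) = (\<lambda>y. \<Sum>v\<in>F \<union> G. ((if v \<in> F then c v else 0) + (if v \<in> G then d v else 0)) * v y)"
  proof
    fix y
    have "(\<Sum>v\<in>F. c v * v y) = (\<Sum>v\<in>F \<union> G. (if v \<in> F then c v else 0) * v y)"
      using F G by (intro sum.mono_neutral_cong_left) auto
    moreover have "(\<Sum>v\<in>G. d v * v y) = (\<Sum>v\<in>F \<union> G. (if v \<in> G then d v else 0) * v y)"
      using F G by (intro sum.mono_neutral_cong_left) auto
    ultimately show "u y + w y
      = (\<Sum>v\<in>F \<union> G. ((if v \<in> F then c v else 0) + (if v \<in> G then d v else 0)) * v y)"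
      by (simp add: F(3) G(3) distrib_right sum.distrib)
  qed
  then show ?thesis unfolding cspan_def using F G
    by (intro CollectI exI[of _ "F \<union> G"]
      exI[of _ "\<lambda>v. (if v \<in> F then c v else 0) + (if v \<in> G then d v else 0)"]) simp
qed

lemma cspan_minimal:
  assumes "u \<in> cspan S" "\<And>v. v \<in> S \<Longrightarrow> v \<in> iota ` parity False"
  shows "u \<in> iota ` parity False"
proof -
  obtain F c where F: "finite F" "F \<subseteq> S" "u = (\<lambda>y. \<Sum>v\<in>F. c v * v y)"
    using assms by (auto simp: cspan_def)
  have "\<forall>v\<in>F. \<exists>p. p \<in> parity False \<and> v = iota p" using F assms(2) by blast
  then obtain p where p: "\<And>v. v \<in> F \<Longrightarrow> p v \<in> parity False \<and> v = iota (p v)" by metis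
  have "u = iota (\<Sum>v\<in>F. const (c v) * p v)"
    unfolding F(3) iota_sum iota_const_mult
  proof (intro ext sum.cong refl)
    fix y v assume "v \<in> F"
    then have "iota (p v) = v" using p by metis
    then show "c v * v y = c v * iota (p v) y" by simp
  qed
  then show ?thesis using p by (blast intro: parity_sum parity_const_mult)
qed

text \<open>Evaluation at the points 1 to \<open>N - 2\<close> is triangular: the polynomial of
  index \<open>a\<close> vanishes at all \<open>i < a\<close> and takes the nonzero value
  \<open>N - 1 - a\<close> at \<open>a\<close>. The coefficients can thus be solved for one after
  another, and the remaining difference has \<open>N - 2\<close> roots but degree at most
  \<open>N - 3\<close>.\<close>

lemma bpoly_spanning:
  assumes "degree f + 3 \<le> N"
  shows "\<exists>c. f = (\<Sum>a\<in>{1..N - 2}. smult (c a) (bpoly a (N - 1 - a)))"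
proof -
  have val: "poly (bpoly a (N - 1 - a)) (of_nat i)
      = of_nat ((i - 1 choose (a - 1)) * (N - 1 - i choose (N - 1 - a - 1)))"
    if "1 \<le> i" "i \<le> N - 2" "1 \<le> a" "a \<le> N - 2" for a i
    using bfun_of_nat[of i a "N - 1 - a"] that by (simp add: poly_bpoly)
  have "\<exists>c. \<forall>i\<in>{1..m}. poly f (of_nat i) = (\<Sum>a\<in>{1..m}. c a * poly (bpoly a (N - 1 - a)) (of_nat i))"
    if "m \<le> N - 2" for m
    using that
  proof (induction m)
    case (Suc m)
    then obtain c where c: "\<And>i. i \<in> {1..m} \<Longrightarrow>
        poly f (of_nat i) = (\<Sum>a\<in>{1..m}. c a * poly (bpoly a (N - 1 - a)) (of_nat i))"
      by fastforce
    define e where "e = (poly f (of_nat (Suc m))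
      - (\<Sum>a\<in>{1..m}. c a * poly (bpoly a (N - 1 - a)) (of_nat (Suc m)))) / of_nat (N - 2 - m)"
    have diag: "poly (bpoly (Suc m) (N - 1 - Suc m)) (of_nat (Suc m)) = of_nat (N - 2 - m)"
    proof -
      have "N - 1 - Suc m = Suc (N - 3 - m)" "N - 2 - m = Suc (N - 3 - m)" using Suc.prems by auto
      then show ?thesis using val[of "Suc m" "Suc m"] Suc.prems by simp
    qed
    have "poly f (of_nat i) = (\<Sum>a\<in>{1..Suc m}. (c(Suc m := e)) a * poly (bpoly a (N - 1 - a)) (of_nat i))"
      if i: "i \<in> {1..Suc m}" for i
    proof -
      have split: "(\<Sum>a\<in>{1..Suc m}. (c(Suc m := e)) a * poly (bpoly a (N - 1 - a)) (of_nat i))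
        = (\<Sum>a\<in>{1..m}. c a * poly (bpoly a (N - 1 - a)) (of_nat i))
          + e * poly (bpoly (Suc m) (N - 1 - Suc m)) (of_nat i)"
        by (simp del: of_nat_Suc)
      show ?thesis
      proof (cases "i = Suc m")
        case True
        have "(of_nat (N - 2 - m) :: complex) \<noteq> 0"
          unfolding of_nat_eq_0_iff using Suc.prems by simp
        then have "e * of_nat (N - 2 - m) = poly f (of_nat (Suc m))
          - (\<Sum>a\<in>{1..m}. c a * poly (bpoly a (N - 1 - a)) (of_nat (Suc m)))"
          unfolding e_def times_divide_eq_left by (rule nonzero_mult_div_cancel_right)
        then show ?thesis using split[unfolded True diag] unfolding True 
          by (simp only: add_diff_eq add_diff_cancel_left')
      next
        case False
        then have "poly (bpoly (Suc m) (N - 1 - Suc m)) (of_nat i) = 0"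
        proof -
          have "i - 1 < m" using False i by auto
          then show ?thesis using val[of i "Suc m"] i Suc.prems by simp
        qed
        then show ?thesis using False i unfolding split by (simp add: c)
      qed
    qed
    then show ?case by blast
  qed simp
  then obtain c where c: "\<And>i. i \<in> {1..N - 2} \<Longrightarrow>
      poly f (of_nat i) = (\<Sum>a\<in>{1..N - 2}. c a * poly (bpoly a (N - 1 - a)) (of_nat i))"
    by blast
  define h where "h = f - (\<Sum>a\<in>{1..N - 2}. smult (c a) (bpoly a (N - 1 - a)))"
  have "h = 0"
  proof (rule ccontr)
    assume h: "h \<noteq> 0"
    have "of_nat ` {1..N - 2} \<subseteq> {x. poly h x = 0}"
      using c by (auto simp: h_def poly_sum)
    then have "card (of_nat ` {1..N - 2} :: complex set) \<le> card {x. poly h x = 0}"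
      using poly_roots_finite[OF h] by (rule card_mono[rotated])
    also have "\<dots> \<le> degree h" by (rule card_poly_roots_bound[OF h])
    also have "\<dots> \<le> N - 3"
    proof -
      have "degree (smult (c a) (bpoly a (N - 1 - a))) \<le> N - 3" if "a \<in> {1..N - 2}" for a
      proof -
        have "a \<ge> 1" "N - 1 - a \<ge> 1" "a + (N - 1 - a) = N - 1" using that by auto
        then have "degree (bpoly a (N - 1 - a)) \<le> N - 3"
          using degree_bpoly[of a "N - 1 - a"] by linarith
        then show ?thesis by (rule order_trans[OF degree_smult_le])
      qed
      then show ?thesis unfolding h_def using assms
        by (intro degree_diff_le degree_sum_le) auto
    qed
    finally show False using assms by (simp add: card_image inj_on_def)
  qed
  then show ?thesis by (intro exI[of _ c]) (simp add: h_def)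
qed

text \<open>\<open>bpoly_spanning\<close> expands a generator into elements \<open>v_{-2} u\<close>
  with v = alpha(-a) alpha(-b) 1 and \<open>a + b = N - 1\<close>, both \<open>v\<close> and
  \<open>u\<close> being fixed by \<open>theta\<close>.\<close>

lemma iota_C2quad_C2:
  assumes "p \<in> C2quad k"
  shows "iota p \<in> C2VLplus k"
  using assms
proof induction
  case zero
  show ?case by (simp add: C2VLplus_def cspan_zero)
next
  case (add p q)
  then show ?case by (simp add: C2VLplus_def iota_add cspan_add)
next
  case (scale p c)
  then show ?case by (simp add: C2VLplus_def iota_const_mult cspan_scale)
next
  case (gen f N u)
  obtain c where c: "f = (\<Sum>a\<in>{1..N - 2}. smult (c a) (bpoly a (N - 1 - a)))"
    using bpoly_spanning[OF gen(1)] by blast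
  have "poly f = (\<lambda>z. \<Sum>a\<in>{1..N - 2}. c a * bfun N a (N - 1 - a) z)"
  proof
    fix z
    show "poly f z = (\<Sum>a\<in>{1..N - 2}. c a * bfun N a (N - 1 - a) z)"
      unfolding c poly_sum by (intro sum.cong) (auto simp: poly_bpoly)
  qed
  then have *: "qop k N (poly f) u = (\<Sum>a\<in>{1..N - 2}. const (c a) * qop k N (bfun N a (N - 1 - a)) u)"
    by (simp add: qop_linear)
  have C2: "iota (qop k N (bfun N a (N - 1 - a)) u) \<in> C2VLplus k" if "a \<in> {1..N - 2}" for a
  proof -
    have "iota (qop k N (bfun N a (N - 1 - a)) u) = mode k (iota (mon {#a, N - 1 - a#})) (-2) (iota u)"
      using that by (intro mode_pair_iota[symmetric]) auto
    moreover have "iota (mon {#a, N - 1 - a#}) \<in> VLplus" "iota u \<in> VLplus"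
      using that gen(2) M1plus_subset_VLplus by (auto simp: M1plus_eq)
    ultimately show ?thesis unfolding C2VLplus_def by (intro cspan_base) blast
  qed
  have "iota (\<Sum>a\<in>A. const (c a) * qop k N (bfun N a (N - 1 - a)) u) \<in> C2VLplus k"
    if "finite A" "A \<subseteq> {1..N - 2}" for A
    using that
  proof (induction A)
    case (insert a A)
    then show ?case
      using C2[of a] by (simp add: C2VLplus_def iota_add iota_const_mult cspan_add cspan_scale)
  qed (simp add: C2VLplus_def cspan_zero)
  then show ?case unfolding * by simp
qed

lemma iota_LJspan:
  assumes "p \<in> LJspan k"
  shows "iota p \<in> cspan {(Lm2 k ^^ s) ((Jm1 k ^^ t) vac) | s t. True}"
  using assms
proof induction
  case (one s)
  have "iota ((Lm2_op k ^^ s) 1) = (Lm2 k ^^ s) ((Jm1 k ^^ 0) vac)"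
    by (simp add: vac_iota Lm2_funpow_iota)
  then show ?case by (intro cspan_base) blast
next
  case (J s)
  have "iota ((Lm2_op k ^^ s) (Jpoly k)) = (Lm2 k ^^ s) ((Jm1 k ^^ 1) vac)"
    by (simp add: Jm1_vac Lm2_funpow_iota)
  then show ?case by (intro cspan_base) blast
qed (simp_all add: iota_add iota_const_mult cspan_zero cspan_add cspan_scale)

text \<open>This gives the inclusion of the spanned space in \<open>M(1)^+ + C_2\<close>; all powers
  of \<open>J_{-1}\<close> are covered by parity alone.\<close>

lemma generators_M1plus: "(Lm2 k ^^ s) ((Jm1 k ^^ t) vac) \<in> iota ` parity False"
proof -
  have t: "(Jm1 k ^^ t) vac \<in> iota ` parity False"
  proof (induction t)
    case 0
    show ?case by (simp add: vac_iota)
  next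
    case (Suc t)
    then obtain p where p: "p \<in> parity False" "(Jm1 k ^^ t) vac = iota p" by blast
    then show ?case by (auto elim!: Jm1_iota[of p k])
  qed
  show ?thesis
    by (induction s) (use t in \<open>auto simp: Lm2_iota parity_Lm2_op\<close>)
qed

theorem theorem4p9:
  fixes k :: nat
  assumes "k \<ge> 3"
  shows "vsum M1plus (C2VLplus k)
         = vsum (cspan {(Lm2 k ^^ s) ((Jm1 k ^^ t) vac) | s t. True}) (C2VLplus k)"
proof (intro equalityI subsetI)
  fix x assume "x \<in> vsum M1plus (C2VLplus k)"
  then obtain p b where p: "p \<in> parity False" and b: "b \<in> C2VLplus k"
    and x: "x = (\<lambda>y. iota p y + b y)"
    by (auto simp: vsum_def M1plus_eq)
  have "p \<in> LJ_mod_C2 k" using LJ_mod_C2_parity p assms by simp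
  then obtain s where s: "s \<in> LJspan k" "p - s \<in> C2quad k" by (auto simp: LJ_mod_C2_def)
  have "iota p = (\<lambda>y. iota s y + iota (p - s) y)"
    unfolding iota_add[symmetric] by simp
  then have "x = (\<lambda>y. iota s y + (iota (p - s) y + b y))"
    by (simp add: x fun_eq_iff add.assoc)
  moreover have "(\<lambda>y. iota (p - s) y + b y) \<in> C2VLplus k"
    using iota_C2quad_C2[OF s(2)] b by (simp add: C2VLplus_def cspan_add)
  ultimately show "x \<in> vsum (cspan {(Lm2 k ^^ s) ((Jm1 k ^^ t) vac) | s t. True}) (C2VLplus k)"
    using iota_LJspan[OF s(1)] unfolding vsum_def
    by (intro CollectI exI[of _ "iota s"] exI[of _ "\<lambda>y. iota (p - s) y + b y"] conjI)
next
  fix x assume "x \<in> vsum (cspan {(Lm2 k ^^ s) ((Jm1 k ^^ t) vac) | s t. True}) (C2VLplus k)"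
  then obtain a b where a: "a \<in> cspan {(Lm2 k ^^ s) ((Jm1 k ^^ t) vac) | s t. True}"
    and "b \<in> C2VLplus k" "x = (\<lambda>y. a y + b y)"
    by (auto simp: vsum_def)
  moreover have "a \<in> M1plus"
    unfolding M1plus_eq using a by (rule cspan_minimal) (use generators_M1plus in blast)
  ultimately show "x \<in> vsum M1plus (C2VLplus k)" unfolding vsum_def by blast
qed

end
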